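(* Let $K=(K_{j\rho l\sigma})_{1\le j,l\le d;\ \rho,\sigma\in\mathcal{R}}$ be a real tensor. Assume that $K_{j\rho l\sigma}=K_{l\sigma j\rho}$ and additionally $K_{j\rho l\sigma}=K_{j(-\rho)l(-\sigma)}$ for all $j,l,\rho,\sigma$. Let $\lambda_{\rm LH}(K)>0$, $K[\xi\otimes s(k),\xi\otimes s(k)]\ge0$ for all $\xi,k\in\mathbb{R}^d$ and $$K[\xi\otimes c(k),\xi\otimes c(k)]\ge\gamma|\xi|^2|c(k)|^2$$ for all $\xi,k\in\mathbb{R}^d$ and some $\gamma>0$, where $c(k)_\rho=\cos(\rho k)-1$ and $s(k)_\rho=\sin(\rho k)$ for $\rho\in\mathcal{R}$. Then $\lambda_{\rm atom}(K)>0$.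
   Context: $\mathcal{R}\subset\mathbb{Z}^d\setminus\{0\}$ is a finite set with $\operatorname{span}_{\mathbb{Z}}\mathcal{R}=\mathbb{Z}^d$ and $\mathcal{R}=-\mathcal{R}$. $\rho k$ denotes the Euclidean scalar product. $K[A,B]=\sum_{j,l,\rho,\sigma}K_{j\rho l\sigma}A_{j\rho}B_{l\sigma}$ for $A,B\in\mathbb{R}^{d\times\mathcal{R}}$; for $\xi\in\mathbb{R}^d$, $b\in\mathbb{R}^{\mathcal{R}}$, $(\xi\otimes b)_{j\rho}=\xi_jb_\rho$. Legendre–Hadamard constant: with $L[A,B]=K[(A\rho)_{\rho\in\mathcal{R}},(B\rho)_{\rho\in\mathcal{R}}]$ for $A,B\in\mathbb{R}^{d\times d}$, $\lambda_{\rm LH}(K)=\inf_{\xi,\eta\in\mathbb{R}^d\setminus\{0\}}\frac{L[\xi\otimes\eta,\xi\otimes\eta]}{|\xi|^2|\eta|^2}$. Atomistic stability constant: $D_{\mathcal{R},\varepsilon}y(x)=\big(\frac{y(x+\varepsilon\rho)-y(x)}{\varepsilon}\big)_{\rho\in\mathcal{R}}$; $R_0=\max\{\max_{\rho\in\mathcal{R}}|\rho|,\sqrt d/4\}$; for an open, bounded, nonempty $\Omega\subset\mathbb{R}^d$, $\operatorname{sint}_\varepsilon\Omega=\{x\in\Omega\cap\varepsilon\mathbb{Z}^d:\operatorname{dist}(x,\partial\Omega)>\varepsilon R_0\}$ and $\mathcal{A}_\varepsilon(\Omega,0)$ is the set of $y\colon\Omega\cap\varepsilon\mathbb{Z}^d\to\mathbb{R}^d$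 with $y(x)=0$ whenever $\operatorname{dist}(x,\partial\Omega)\le2\varepsilon R_0$; then $$\lambda_{\rm atom}(K)=\inf_{\varepsilon>0}\ \inf_{y\in\mathcal{A}_\varepsilon(\Omega,0),\,y\ne0}\frac{\sum_{x\in\operatorname{sint}_\varepsilon\Omega}K[D_{\mathcal{R},\varepsilon}y(x),D_{\mathcal{R},\varepsilon}y(x)]}{\sum_{x\in\operatorname{sint}_\varepsilon\Omega}|D_{\mathcal{R},\varepsilon}y(x)|^2},$$ which does not depend on the choice of $\Omega$. *)

theory Defs
  imports "HOL-Analysis.Analysis"
begin

definition int_lattice :: "(real ^ 'd) set" where
  "int_lattice = {z. \<forall>i. z $ i \<in> \<int>}"

text \<open>The integer span is the library's span for the \<open>\<int>\<close>-module structure on \<open>\<real>\<^sup>d\<close>.\<close>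

interpretation int_module: module "\<lambda>(n::int) (v :: real ^ 'd). of_int n *\<^sub>R v"
  by unfold_locales (simp_all add: scaleR_add_right scaleR_add_left)

definition int_span :: "(real ^ 'd) set \<Rightarrow> (real ^ 'd) set" where
  "int_span S = module.span (\<lambda>(n::int) v. of_int n *\<^sub>R v) S"

text \<open>
  An element \<open>A\<close> of \<open>\<real>\<^bsup>d\<times>R\<^esup>\<close> is represented by its columns: \<open>A\<^bsub>j\<rho>\<^esub>\<close> is \<open>A \<rho> $ j\<close>.
  An element \<open>b\<close> of \<open>\<real>\<^bsup>R\<^esup>\<close> is a function of \<open>\<rho>\<close>, and the tensor entry \<open>K\<^bsub>j\<rho>l\<sigma>\<^esub>\<close> is \<open>K j \<rho> l \<sigma>\<close>.
  Only values at arguments \<open>\<rho>, \<sigma> \<in> R\<close> are ever used.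
\<close>

type_synonym 'd tensor = "'d \<Rightarrow> real ^ 'd \<Rightarrow> 'd \<Rightarrow> real ^ 'd \<Rightarrow> real"
type_synonym 'd columns = "real ^ 'd \<Rightarrow> real ^ 'd"

definition tensor_form ::
  "(real ^ 'd) set \<Rightarrow> 'd tensor \<Rightarrow> 'd columns \<Rightarrow> 'd columns \<Rightarrow> real" where
  "tensor_form R K A B =
     (\<Sum>j\<in>UNIV. \<Sum>l\<in>UNIV. \<Sum>\<rho>\<in>R. \<Sum>\<sigma>\<in>R. K j \<rho> l \<sigma> * A \<rho> $ j * B \<sigma> $ l)"

definition columns_norm_sq :: "(real ^ 'd) set \<Rightarrow> 'd columns \<Rightarrow> real" where
  "columns_norm_sq R A = (\<Sum>j\<in>UNIV. \<Sum>\<rho>\<in>R. (A \<rho> $ j)\<^sup>2)"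

definition outer_columns :: "real ^ 'd \<Rightarrow> (real ^ 'd \<Rightarrow> real) \<Rightarrow> 'd columns" where
  "outer_columns \<xi> b = (\<lambda>\<rho>. \<chi> j. \<xi> $ j * b \<rho>)"

definition outer_matrix :: "real ^ 'd \<Rightarrow> real ^ 'd \<Rightarrow> real ^ 'd ^ 'd" where
  "outer_matrix \<xi> \<eta> = (\<chi> i j. \<xi> $ i * \<eta> $ j)"

definition c_vec :: "real ^ 'd \<Rightarrow> real ^ 'd \<Rightarrow> real" where
  "c_vec k = (\<lambda>\<rho>. cos (\<rho> \<bullet> k) - 1)"

definition s_vec :: "real ^ 'd \<Rightarrow> real ^ 'd \<Rightarrow> real" where
  "s_vec k = (\<lambda>\<rho>. sin (\<rho> \<bullet> k))"

definition LH_form ::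
  "(real ^ 'd) set \<Rightarrow> 'd tensor \<Rightarrow> real ^ 'd ^ 'd \<Rightarrow> real ^ 'd ^ 'd \<Rightarrow> real" where
  "LH_form R K A B = tensor_form R K (\<lambda>\<rho>. A *v \<rho>) (\<lambda>\<rho>. B *v \<rho>)"

text \<open>
  Both stability constants are infima in \<open>ereal\<close>. For \<open>lambda_atom\<close> this matters: for large
  \<open>\<epsilon>\<close> the only admissible \<open>y\<close> is \<open>0\<close>, and the inner infimum over the empty set is \<open>\<infinity>\<close>.
\<close>

definition lambda_LH :: "(real ^ 'd) set \<Rightarrow> 'd tensor \<Rightarrow> ereal" where
  "lambda_LH R K =
     (INF \<xi>\<in>UNIV - {0}. INF \<eta>\<in>UNIV - {0}.
        ereal (LH_form R K (outer_matrix \<xi> \<eta>) (outer_matrix \<xi> \<eta>)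
                 / ((norm \<xi>)\<^sup>2 * (norm \<eta>)\<^sup>2)))"

definition scaled_lattice :: "real \<Rightarrow> (real ^ 'd) set" where
  "scaled_lattice \<epsilon> = (\<lambda>z. \<epsilon> *\<^sub>R z) ` int_lattice"

definition discrete_grad :: "real \<Rightarrow> (real ^ 'd \<Rightarrow> real ^ 'd) \<Rightarrow> real ^ 'd \<Rightarrow> 'd columns" where
  "discrete_grad \<epsilon> y x = (\<lambda>\<rho>. (y (x + \<epsilon> *\<^sub>R \<rho>) - y x) /\<^sub>R \<epsilon>)"

definition R0 :: "(real ^ 'd) set \<Rightarrow> real" where
  "R0 R = max (Max (norm ` R)) (sqrt (real CARD('d)) / 4)"

definition sint :: "(real ^ 'd) set \<Rightarrow> real \<Rightarrow> (real ^ 'd) set \<Rightarrow> (real ^ 'd) set" where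
  "sint R \<epsilon> \<Omega> = {x \<in> \<Omega> \<inter> scaled_lattice \<epsilon>. infdist x (frontier \<Omega>) > \<epsilon> * R0 R}"

text \<open>
  Functions on \<open>\<Omega> \<inter> \<epsilon>\<int>\<^sup>d\<close> are extensional functions; in particular the zero function is
  \<open>\<lambda>x\<in>\<Omega> \<inter> scaled_lattice \<epsilon>. 0\<close>. For \<open>x \<in> sint R \<epsilon> \<Omega>\<close> and \<open>\<rho> \<in> R\<close> the point \<open>x + \<epsilon>\<rho>\<close> lies
  in \<open>\<Omega> \<inter> \<epsilon>\<int>\<^sup>d\<close>, so difference quotients never use values outside this set.
\<close>

definition admissible ::
  "(real ^ 'd) set \<Rightarrow> real \<Rightarrow> (real ^ 'd) set \<Rightarrow> (real ^ 'd \<Rightarrow> real ^ 'd) set" where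
  "admissible R \<epsilon> \<Omega> =
     {y \<in> (\<Omega> \<inter> scaled_lattice \<epsilon>) \<rightarrow>\<^sub>E UNIV.
        \<forall>x \<in> \<Omega> \<inter> scaled_lattice \<epsilon>. infdist x (frontier \<Omega>) \<le> 2 * \<epsilon> * R0 R \<longrightarrow> y x = 0}"

definition lambda_atom :: "(real ^ 'd) set \<Rightarrow> (real ^ 'd) set \<Rightarrow> 'd tensor \<Rightarrow> ereal" where
  "lambda_atom R \<Omega> K =
     (INF \<epsilon>\<in>{0<..}. INF y\<in>admissible R \<epsilon> \<Omega> - {\<lambda>x\<in>\<Omega> \<inter> scaled_lattice \<epsilon>. 0}.
        ereal ((\<Sum>x\<in>sint R \<epsilon> \<Omega>. tensor_form R K (discrete_grad \<epsilon> y x) (discrete_grad \<epsilon> y x))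
                 / (\<Sum>x\<in>sint R \<epsilon> \<Omega>. columns_norm_sq R (discrete_grad \<epsilon> y x))))"

end

theory Submission
  imports Defs
begin

text \<open>
  After rescaling, an admissible function is a finitely supported \<open>u\<close> on \<open>\<int>\<^sup>d\<close>. Such a \<open>u\<close> also lives
  on the torus \<open>(\<int>/N)\<^sup>d\<close> for large \<open>N\<close>, so Parseval's identity for the finite Fourier transform turns
  \<open>\<Sum>\<^sub>x K[Du(x), Du(x)]\<close> into an average over frequencies \<open>k\<close>. The transform of \<open>Du\<close> is the transform
  of \<open>u\<close> times \<open>c(k) + i s(k)\<close>; since \<open>c\<close> is even and \<open>s\<close> is odd in \<open>\<rho>\<close>, the parity assumption on \<open>K\<close>
  removes all mixed terms. Coercivity thus follows from the lower bound
  \<open>K[\<xi> \<otimes> c, \<xi> \<otimes> c] + K[\<xi> \<otimes> s, \<xi> \<otimes> s] \<ge> t |\<xi>|\<^sup>2 (|c|\<^sup>2 + |s|\<^sup>2)\<close>, uniform in \<open>k\<close>, where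
  subtracting \<open>t\<close> from the diagonal entries of \<open>K\<close> reduces coercivity to nonnegativity.
\<close>

section \<open>Finite Fourier transform\<close>

text \<open>A geometric series whose ratio is an \<open>N\<close>-th root of unity, so it cancels
  unless the ratio is 1. The bound on \<open>a\<close> excludes the nonzero multiples of
  \<open>N\<close>, leaving \<open>a = 0\<close> as the only case of ratio 1.\<close>

lemma sum_cis_roots_of_unity:
  fixes a :: real
  assumes "a \<in> \<int>" and "\<bar>a\<bar> < real N"
  shows "(\<Sum>m<N. cis (2 * pi * real m / real N * a)) = (if a = 0 then of_nat N else 0)"
proof (cases "a = 0")
  case False
  have N: "N > 0"
    using assms by (cases N) auto
  define w where "w = cis (2 * pi * a / real N)"
  have "w \<noteq> 1"
  proof
    assume "w = 1"
    then have "cos (2 * pi * a / real N) = 1"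
      by (metis w_def cis.sel(1) one_complex.sel(1))
    then obtain n :: int where "2 * pi * a / real N = real_of_int n * 2 * pi"
      by (auto simp: cos_one_2pi_int)
    then have a: "a = real_of_int n * real N"
      using N by (simp add: field_simps)
    then have "n \<noteq> 0"
      using False by auto
    then have "1 \<le> \<bar>real_of_int n\<bar>"
      by linarith
    then have "real N \<le> \<bar>a\<bar>"
      using N by (simp add: a abs_mult)
    with assms show False by linarith
  qed
  moreover have "w ^ N = 1"
    using N assms(1) by (auto simp: w_def Complex.DeMoivre)
  moreover have "cis (2 * pi * real m / real N * a) = w ^ m" for m
    by (simp add: w_def Complex.DeMoivre mult_ac)
  ultimately show ?thesis
    using False by (simp add: geometric_sum)
qed simp

text \<open>The dual grid of the torus with \<open>N\<close> points in each direction, inside one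
  period of length 2 pi per coordinate.\<close>

definition frequency :: "nat \<Rightarrow> ('d \<Rightarrow> nat) \<Rightarrow> real ^ 'd" where
  "frequency N g = (\<chi> i. 2 * pi * real (g i) / real N)"

text \<open>Over \<open>UNIV\<close> extensionality is vacuous, so this is the set of all maps into
  \<open>{..<N}\<close>; the \<open>PiE\<close> form lets a sum of products factor through
  \<open>prod_sum_PiE\<close>.\<close>

abbreviation frequencies :: "nat \<Rightarrow> ('d \<Rightarrow> nat) set" where
  "frequencies N \<equiv> PiE UNIV (\<lambda>_. {..<N})"

lemma cis_sum: "finite A \<Longrightarrow> cis (\<Sum>i\<in>A. f i) = (\<Prod>i\<in>A. cis (f i))"
  by (induction A rule: finite_induct) (auto simp: cis_mult [symmetric])

text \<open>The exponential is a product over coordinates, so the sum over the grid is a product of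
  one-dimensional sums, and one nonzero coordinate of \<open>z\<close> kills it. The cosine sum is
  the real part.\<close>

lemma sum_cos_frequency:
  fixes z :: "real ^ 'd"
  assumes "z \<in> int_lattice" and "\<And>i. \<bar>z $ i\<bar> < real N"
  shows "(\<Sum>g\<in>frequencies N. cos (frequency N g \<bullet> z)) = (if z = 0 then real N ^ CARD('d) else 0)"
proof -
  have "(\<Sum>g\<in>frequencies N. cis (frequency N g \<bullet> z))
      = (\<Sum>g\<in>frequencies N. \<Prod>i\<in>UNIV. cis (2 * pi * real (g i) / real N * z $ i))"
    by (simp add: frequency_def inner_vec_def cis_sum)
  also have "\<dots> = (\<Prod>i\<in>UNIV. \<Sum>m<N. cis (2 * pi * real m / real N * z $ i))"
    by (rule prod_sum_PiE [symmetric]) auto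
  also have "\<dots> = (\<Prod>i\<in>UNIV. if z $ i = 0 then of_nat N else 0)"
    using assms by (intro prod.cong refl sum_cis_roots_of_unity) (auto simp: int_lattice_def)
  also have "\<dots> = of_real (if z = 0 then real N ^ CARD('d) else 0)"
    by (auto simp: vec_eq_iff)
  finally have "Re (\<Sum>g\<in>frequencies N. cis (frequency N g \<bullet> z))
      = (if z = 0 then real N ^ CARD('d) else 0)"
    by (simp only: Re_complex_of_real)
  then show ?thesis
    by simp
qed

lemma int_lattice_diff: "x \<in> int_lattice \<Longrightarrow> y \<in> int_lattice \<Longrightarrow> x - y \<in> int_lattice"
  by (auto simp: int_lattice_def)

lemma int_lattice_add: "x \<in> int_lattice \<Longrightarrow> y \<in> int_lattice \<Longrightarrow> x + y \<in> int_lattice"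
  by (auto simp: int_lattice_def)

text \<open>The cosine and sine sums are real and imaginary parts of the transforms, which keeps
  everything real. The addition theorem turns the summand into a double sum of
  \<open>cos (k \<bullet> (x - y))\<close>, and orthogonality leaves the diagonal. The bound by
  \<open>N\<close> rules out aliasing: distinct points of \<open>T\<close> stay distinct on the
  torus.\<close>

lemma parseval:
  fixes f g :: "real ^ 'd \<Rightarrow> real"
  assumes "finite T" and "T \<subseteq> int_lattice"
    and N: "\<And>x y i. x \<in> T \<Longrightarrow> y \<in> T \<Longrightarrow> \<bar>(x - y) $ i\<bar> < real N"
  shows "(\<Sum>h\<in>frequencies N.
            (\<Sum>x\<in>T. f x * cos (frequency N h \<bullet> x)) * (\<Sum>x\<in>T. g x * cos (frequency N h \<bullet> x)) +
            (\<Sum>x\<in>T. f x * sin (frequency N h \<bullet> x)) * (\<Sum>x\<in>T. g x * sin (frequency N h \<bullet> x)))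
         = real N ^ CARD('d) * (\<Sum>x\<in>T. f x * g x)"
proof -
  have "(\<Sum>x\<in>T. f x * cos (k \<bullet> x)) * (\<Sum>x\<in>T. g x * cos (k \<bullet> x)) +
        (\<Sum>x\<in>T. f x * sin (k \<bullet> x)) * (\<Sum>x\<in>T. g x * sin (k \<bullet> x))
      = (\<Sum>x\<in>T. \<Sum>y\<in>T. f x * g y * cos (k \<bullet> (x - y)))" for k
    unfolding sum_product sum.distrib [symmetric]
    by (intro sum.cong refl) (simp add: inner_diff_right cos_diff algebra_simps)
  then have "(\<Sum>h\<in>frequencies N.
            (\<Sum>x\<in>T. f x * cos (frequency N h \<bullet> x)) * (\<Sum>x\<in>T. g x * cos (frequency N h \<bullet> x)) +
            (\<Sum>x\<in>T. f x * sin (frequency N h \<bullet> x)) * (\<Sum>x\<in>T. g x * sin (frequency N h \<bullet> x)))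
      = (\<Sum>h\<in>frequencies N. \<Sum>x\<in>T. \<Sum>y\<in>T. f x * g y * cos (frequency N h \<bullet> (x - y)))"
    by simp
  also have "\<dots> = (\<Sum>x\<in>T. \<Sum>h\<in>frequencies N. \<Sum>y\<in>T. f x * g y * cos (frequency N h \<bullet> (x - y)))"
    by (rule sum.swap)
  also have "\<dots> = (\<Sum>x\<in>T. \<Sum>y\<in>T. \<Sum>h\<in>frequencies N. f x * g y * cos (frequency N h \<bullet> (x - y)))"
    by (rule sum.cong [OF refl], rule sum.swap)
  also have "\<dots> = (\<Sum>x\<in>T. \<Sum>y\<in>T. f x * g y * (if x = y then real N ^ CARD('d) else 0))"
  proof (intro sum.cong refl)
    fix x y assume xy: "x \<in> T" "y \<in> T"
    then have "x - y \<in> int_lattice"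
      using assms(2) int_lattice_diff by blast
    with N xy show "(\<Sum>h\<in>frequencies N. f x * g y * cos (frequency N h \<bullet> (x - y)))
        = f x * g y * (if x = y then real N ^ CARD('d) else 0)"
      by (subst sum_distrib_left [symmetric], subst sum_cos_frequency) auto
  qed
  also have "\<dots> = (\<Sum>x\<in>T. f x * g x * real N ^ CARD('d))"
    using assms(1) by (intro sum.cong refl) (simp add: if_distrib cong: if_cong)
  finally show ?thesis
    by (simp add: sum_distrib_left mult_ac)
qed

section \<open>Sums over the lattice in terms of the symbol\<close>

lemma tensor_form_cong:
  assumes "\<And>\<rho>. \<rho> \<in> R \<Longrightarrow> A \<rho> = A' \<rho>" and "\<And>\<rho>. \<rho> \<in> R \<Longrightarrow> B \<rho> = B' \<rho>"
  shows "tensor_form R K A B = tensor_form R K A' B'"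
  using assms by (simp add: tensor_form_def cong: sum.cong)

lemma tensor_form_add_left:
  "tensor_form R K (\<lambda>\<rho>. A \<rho> + A' \<rho>) B = tensor_form R K A B + tensor_form R K A' B"
  by (simp add: tensor_form_def sum.distrib algebra_simps)

lemma tensor_form_add_right:
  "tensor_form R K A (\<lambda>\<rho>. B \<rho> + B' \<rho>) = tensor_form R K A B + tensor_form R K A B'"
  by (simp add: tensor_form_def sum.distrib algebra_simps)

lemma tensor_form_scale_left:
  "tensor_form R K (\<lambda>\<rho>. t *\<^sub>R A \<rho>) B = t * tensor_form R K A B"
  by (simp add: tensor_form_def sum_distrib_left mult_ac)

lemma tensor_form_scale_right:
  "tensor_form R K A (\<lambda>\<rho>. t *\<^sub>R B \<rho>) = t * tensor_form R K A B"
  by (simp add: tensor_form_def sum_distrib_left mult_ac)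

text \<open>Negating both summation indices permutes \<open>R\<close> and preserves \<open>K\<close>
  but flips the sign of the product, so the sum equals its own negative. The hypothesis on the
  product covers odd-even and even-odd pairs alike.\<close>

lemma tensor_form_odd_even:
  assumes R: "R = uminus ` R"
    and K: "\<forall>j l. \<forall>\<rho>\<in>R. \<forall>\<sigma>\<in>R. K j \<rho> l \<sigma> = K j (- \<rho>) l (- \<sigma>)"
    and AB: "\<And>\<rho> \<sigma> j l. A (- \<rho>) $ j * B (- \<sigma>) $ l = - (A \<rho> $ j * B \<sigma> $ l)"
  shows "tensor_form R K A B = 0"
proof -
  have reindex: "(\<Sum>\<rho>\<in>R. h \<rho>) = (\<Sum>\<rho>\<in>R. h (- \<rho>))" for h :: "real ^ 'a \<Rightarrow> real"
  proof -
    have "(\<Sum>\<rho>\<in>R. h \<rho>) = (\<Sum>\<rho>\<in>uminus ` R. h \<rho>)"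
      using R by (rule arg_cong)
    also have "\<dots> = (\<Sum>\<rho>\<in>R. h (- \<rho>))"
      by (subst sum.reindex) (auto simp: inj_on_def)
    finally show ?thesis .
  qed
  have "(\<Sum>\<rho>\<in>R. \<Sum>\<sigma>\<in>R. K j \<rho> l \<sigma> * A \<rho> $ j * B \<sigma> $ l)
      = - (\<Sum>\<rho>\<in>R. \<Sum>\<sigma>\<in>R. K j \<rho> l \<sigma> * A \<rho> $ j * B \<sigma> $ l)" (is "?l = - ?l") for j l
  proof -
    have "?l = (\<Sum>\<rho>\<in>R. \<Sum>\<sigma>\<in>R. K j (- \<rho>) l (- \<sigma>) * A (- \<rho>) $ j * B (- \<sigma>) $ l)"
      by (rule trans [OF reindex sum.cong [OF refl reindex]])
    also have "\<dots> = (\<Sum>\<rho>\<in>R. \<Sum>\<sigma>\<in>R. - (K j \<rho> l \<sigma> * A \<rho> $ j * B \<sigma> $ l))"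
    proof (intro sum.cong refl)
      fix \<rho> \<sigma> assume "\<rho> \<in> R" "\<sigma> \<in> R"
      then have "K j (- \<rho>) l (- \<sigma>) = K j \<rho> l \<sigma>"
        by (rule K [rule_format, symmetric])
      then show "K j (- \<rho>) l (- \<sigma>) * A (- \<rho>) $ j * B (- \<sigma>) $ l = - (K j \<rho> l \<sigma> * A \<rho> $ j * B \<sigma> $ l)"
        using AB [of \<rho> j \<sigma> l] by (simp add: mult.assoc)
    qed
    finally show ?thesis
      by (simp add: sum_negf)
  qed
  then have "(\<Sum>\<rho>\<in>R. \<Sum>\<sigma>\<in>R. K j \<rho> l \<sigma> * A \<rho> $ j * B \<sigma> $ l) = 0" for j l
    by (simp only: equal_neg_zero)
  then show ?thesis
    by (simp add: tensor_form_def)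
qed

text \<open>\<open>A\<close> and \<open>B\<close> are the real and imaginary parts of (a + i b)
  tensored with c(k) - i s(k). The terms pairing \<open>c_vec\<close> with \<open>s_vec\<close>
  vanish by parity, which decouples \<open>a\<close> from \<open>b\<close>.\<close>

lemma tensor_form_symbol:
  fixes a b k :: "real ^ 'd"
  assumes "R = uminus ` R"
    and "\<forall>j l. \<forall>\<rho>\<in>R. \<forall>\<sigma>\<in>R. K j \<rho> l \<sigma> = K j (- \<rho>) l (- \<sigma>)"
  defines "A \<equiv> \<lambda>\<rho>. outer_columns a (c_vec k) \<rho> + outer_columns b (s_vec k) \<rho>"
    and "B \<equiv> \<lambda>\<rho>. outer_columns b (c_vec k) \<rho> + outer_columns (- a) (s_vec k) \<rho>"
  shows "tensor_form R K A A + tensor_form R K B B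
     = tensor_form R K (outer_columns a (c_vec k)) (outer_columns a (c_vec k))
     + tensor_form R K (outer_columns a (s_vec k)) (outer_columns a (s_vec k))
     + (tensor_form R K (outer_columns b (c_vec k)) (outer_columns b (c_vec k))
     + tensor_form R K (outer_columns b (s_vec k)) (outer_columns b (s_vec k)))"
proof -
  have cs: "tensor_form R K (outer_columns v (c_vec k)) (outer_columns w (s_vec k)) = 0" for v w
    by (rule tensor_form_odd_even [OF assms(1,2)]) (simp add: outer_columns_def c_vec_def s_vec_def)
  have sc: "tensor_form R K (outer_columns v (s_vec k)) (outer_columns w (c_vec k)) = 0" for v w
    by (rule tensor_form_odd_even [OF assms(1,2)]) (simp add: outer_columns_def c_vec_def s_vec_def)
  have "tensor_form R K (outer_columns (- a) (s_vec k)) (outer_columns (- a) (s_vec k))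
      = tensor_form R K (outer_columns a (s_vec k)) (outer_columns a (s_vec k))"
    by (simp add: tensor_form_def outer_columns_def)
  then show ?thesis
    by (simp add: A_def B_def tensor_form_add_left tensor_form_add_right cs sc)
qed

section \<open>Summation by parts and positivity over the lattice\<close>

text \<open>Discrete summation by parts, moving the difference onto \<open>\<phi>\<close>. No
  boundary terms appear because \<open>T\<close> contains the support of \<open>u\<close> and its
  translate by \<open>- \<rho>\<close>.\<close>

lemma sum_translate:
  fixes u :: "real ^ 'd \<Rightarrow> real"
  assumes "finite T" and "\<And>x. u x \<noteq> 0 \<Longrightarrow> x \<in> T" and "\<And>x. u (x + \<rho>) \<noteq> 0 \<Longrightarrow> x \<in> T"
  shows "(\<Sum>x\<in>T. (u (x + \<rho>) - u x) * \<phi> x) = (\<Sum>x\<in>T. u x * (\<phi> (x - \<rho>) - \<phi> x))"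
proof -
  define S where "S = {x. u x \<noteq> 0}"
  have S: "S \<subseteq> T" "(\<lambda>x. x - \<rho>) ` S \<subseteq> T"
    using assms(2) assms(3) by (auto simp: S_def)
  have "(\<Sum>x\<in>T. u (x + \<rho>) * \<phi> x) = (\<Sum>x\<in>(\<lambda>x. x - \<rho>) ` S. u (x + \<rho>) * \<phi> x)"
  proof (rule sum.mono_neutral_right [OF assms(1) S(2)])
    show "\<forall>x\<in>T - (\<lambda>x. x - \<rho>) ` S. u (x + \<rho>) * \<phi> x = 0"
      by (auto simp: S_def image_iff) (metis add_diff_cancel)
  qed
  also have "\<dots> = (\<Sum>x\<in>S. u x * \<phi> (x - \<rho>))"
    by (subst sum.reindex) (auto simp: inj_on_def)
  also have "\<dots> = (\<Sum>x\<in>T. u x * \<phi> (x - \<rho>))"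
    by (rule sum.mono_neutral_left [OF assms(1) S(1)]) (auto simp: S_def)
  finally show ?thesis
    by (simp add: left_diff_distrib right_diff_distrib sum_subtractf)
qed

text \<open>Parseval is applied to each pair of entries of the difference field; reassembling the
  entries gives, at every frequency, the symbol evaluated at the cosine and at the sine transform of
  \<open>u\<close>.\<close>

lemma sum_tensor_form_nonneg:
  fixes u :: "real ^ 'd \<Rightarrow> real ^ 'd"
  assumes R: "R = uminus ` R"
    and K: "\<forall>j l. \<forall>\<rho>\<in>R. \<forall>\<sigma>\<in>R. K j \<rho> l \<sigma> = K j (- \<rho>) l (- \<sigma>)"
    and symbol: "\<And>\<xi> k. tensor_form R K (outer_columns \<xi> (c_vec k)) (outer_columns \<xi> (c_vec k))
       + tensor_form R K (outer_columns \<xi> (s_vec k)) (outer_columns \<xi> (s_vec k)) \<ge> 0"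
    and T: "finite T" "T \<subseteq> int_lattice"
    and u0: "\<And>x. u x \<noteq> 0 \<Longrightarrow> x \<in> T"
    and u1: "\<And>x \<rho>. \<rho> \<in> R \<Longrightarrow> u (x + \<rho>) \<noteq> 0 \<Longrightarrow> x \<in> T"
  shows "(\<Sum>x\<in>T. tensor_form R K (\<lambda>\<rho>. u (x + \<rho>) - u x) (\<lambda>\<rho>. u (x + \<rho>) - u x)) \<ge> 0"
proof -
  define D where "D = (\<lambda>\<rho> j x. u (x + \<rho>) $ j - u x $ j)"
  obtain B where B: "\<And>x. x \<in> T \<Longrightarrow> norm x \<le> B"
    using T(1) finite_imp_bounded bounded_iff by metis
  \<comment> \<open>\<open>N\<close> exceeds the diameter of \<open>T\<close>, as
    \<open>parseval\<close> requires; the \<open>0\<close> in the maximum makes \<open>N\<close>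
    positive, so that \<open>P\<close> can be divided out at the end.\<close>
  obtain N :: nat where N0: "max 0 (2 * B) < real N"
    using reals_Archimedean2 by blast
  have N: "\<bar>(x - y) $ i\<bar> < real N" if "x \<in> T" "y \<in> T" for x y i
  proof -
    have "\<bar>(x - y) $ i\<bar> \<le> norm (x - y)"
      by (rule component_le_norm_cart)
    also have "\<dots> \<le> norm x + norm y"
      by (rule norm_triangle_ineq4)
    finally show ?thesis
      using B [OF that(1)] B [OF that(2)] N0 by linarith
  qed
  define P where "P = real N ^ CARD('d)"
  define Cu where "Cu = (\<lambda>k. \<chi> j. \<Sum>x\<in>T. u x $ j * cos (k \<bullet> x))"
  define Su where "Su = (\<lambda>k. \<chi> j. \<Sum>x\<in>T. u x $ j * sin (k \<bullet> x))"
  \<comment> \<open>\<open>Ac\<close> and \<open>As\<close> will be the cosine and sine transforms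
    of the difference field. The minus sign before \<open>Cu\<close> comes from expanding
    \<open>sin (k \<bullet> (x - \<rho>))\<close>.\<close>
  define Ac where "Ac = (\<lambda>k \<rho>. outer_columns (Cu k) (c_vec k) \<rho> + outer_columns (Su k) (s_vec k) \<rho>)"
  define As where "As = (\<lambda>k \<rho>. outer_columns (Su k) (c_vec k) \<rho> + outer_columns (- Cu k) (s_vec k) \<rho>)"
  have translate: "(\<Sum>x\<in>T. D \<rho> j x * \<phi> x) = (\<Sum>x\<in>T. u x $ j * (\<phi> (x - \<rho>) - \<phi> x))"
    if "\<rho> \<in> R" for \<rho> j \<phi>
    unfolding D_def
  proof (rule sum_translate [OF T(1)])
    show "x \<in> T" if "u x $ j \<noteq> 0" for x
      using u0 that by (metis zero_index)
    show "x \<in> T" if "u (x + \<rho>) $ j \<noteq> 0" for x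
      using u1 that \<open>\<rho> \<in> R\<close> by (metis zero_index)
  qed
  have cosD: "(\<Sum>x\<in>T. D \<rho> j x * cos (k \<bullet> x)) = Ac k \<rho> $ j" if "\<rho> \<in> R" for \<rho> j k
    unfolding translate [OF that]
    by (simp add: Ac_def outer_columns_def Cu_def Su_def c_vec_def s_vec_def sum_distrib_left
        sum_distrib_right inner_diff_right cos_diff inner_commute [of \<rho>] sum.distrib sum_subtractf
        algebra_simps)
  have sinD: "(\<Sum>x\<in>T. D \<rho> j x * sin (k \<bullet> x)) = As k \<rho> $ j" if "\<rho> \<in> R" for \<rho> j k
    unfolding translate [OF that]
    by (simp add: As_def outer_columns_def Cu_def Su_def c_vec_def s_vec_def sum_distrib_left
        sum_distrib_right inner_diff_right sin_diff inner_commute [of \<rho>] sum.distrib sum_subtractf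
        algebra_simps)
  let ?F = "frequencies N" and ?k = "frequency N"
  have "P * (\<Sum>x\<in>T. tensor_form R K (\<lambda>\<rho>. u (x + \<rho>) - u x) (\<lambda>\<rho>. u (x + \<rho>) - u x))
      = P * (\<Sum>x\<in>T. \<Sum>j\<in>UNIV. \<Sum>l\<in>UNIV. \<Sum>\<rho>\<in>R. \<Sum>\<sigma>\<in>R. K j \<rho> l \<sigma> * (D \<rho> j x * D \<sigma> l x))"
    by (simp add: tensor_form_def D_def mult.assoc)
  \<comment> \<open>The sum over \<open>x\<close> moves innermost, where it is an inner product of
    two scalar functions on \<open>T\<close>.\<close>
  also have "\<dots> = (\<Sum>j\<in>UNIV. \<Sum>l\<in>UNIV. \<Sum>\<rho>\<in>R. \<Sum>\<sigma>\<in>R. K j \<rho> l \<sigma> * (P * (\<Sum>x\<in>T. D \<rho> j x * D \<sigma> l x)))"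
    by (simp only: sum.swap [of _ _ T] sum_distrib_left mult.left_commute [of P])
  also have "\<dots> = (\<Sum>j\<in>UNIV. \<Sum>l\<in>UNIV. \<Sum>\<rho>\<in>R. \<Sum>\<sigma>\<in>R. K j \<rho> l \<sigma> *
      (\<Sum>h\<in>?F. Ac (?k h) \<rho> $ j * Ac (?k h) \<sigma> $ l + As (?k h) \<rho> $ j * As (?k h) \<sigma> $ l))"
  proof (intro sum.cong refl arg_cong2 [where f = "(*)"])
    fix j l \<rho> \<sigma> assume rs: "\<rho> \<in> R" "\<sigma> \<in> R"
    show "P * (\<Sum>x\<in>T. D \<rho> j x * D \<sigma> l x)
        = (\<Sum>h\<in>?F. Ac (?k h) \<rho> $ j * Ac (?k h) \<sigma> $ l + As (?k h) \<rho> $ j * As (?k h) \<sigma> $ l)"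
      unfolding P_def
      by (subst parseval [OF T N, symmetric]; simp only: cosD [OF rs(1)] cosD [OF rs(2)] sinD [OF rs(1)] sinD [OF rs(2)])
  qed
  also have "\<dots> = (\<Sum>h\<in>?F. tensor_form R K (Ac (?k h)) (Ac (?k h)) + tensor_form R K (As (?k h)) (As (?k h)))"
    by (simp only: tensor_form_def sum.swap [of _ _ ?F] sum_distrib_left distrib_left sum.distrib mult.assoc)
  also have "\<dots> \<ge> 0"
  proof (rule sum_nonneg)
    fix h
    show "tensor_form R K (Ac (?k h)) (Ac (?k h)) + tensor_form R K (As (?k h)) (As (?k h)) \<ge> 0"
      unfolding Ac_def As_def tensor_form_symbol [OF R K] by (intro add_nonneg_nonneg symbol)
  qed
  finally have "P * (\<Sum>x\<in>T. tensor_form R K (\<lambda>\<rho>. u (x + \<rho>) - u x) (\<lambda>\<rho>. u (x + \<rho>) - u x)) \<ge> 0" .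
  moreover have "P > 0"
    using N0 by (simp add: P_def)
  ultimately show ?thesis
    by (simp add: zero_le_mult_iff)
qed

section \<open>From nonnegativity to coercivity\<close>

lemma columns_norm_sq_outer: "columns_norm_sq R (outer_columns \<xi> b) = (norm \<xi>)\<^sup>2 * (\<Sum>\<rho>\<in>R. (b \<rho>)\<^sup>2)"
  unfolding columns_norm_sq_def power2_norm_eq_inner inner_vec_def
  by (simp add: outer_columns_def sum_product power2_eq_square mult_ac, rule sum.swap)

text \<open>The subtracted tensor is \<open>t\<close> times the identity, whose quadratic form is
  the squared norm.\<close>

lemma tensor_form_diff_norm:
  assumes "finite R"
  shows "tensor_form R (\<lambda>j \<rho> l \<sigma>. K j \<rho> l \<sigma> - t * (if j = l \<and> \<rho> = \<sigma> then 1 else 0)) A A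
       = tensor_form R K A A - t * columns_norm_sq R A"
proof -
  have "(\<Sum>l\<in>UNIV. \<Sum>\<rho>\<in>R. \<Sum>\<sigma>\<in>R. t * (if j = l \<and> \<rho> = \<sigma> then 1 else 0) * A \<rho> $ j * A \<sigma> $ l)
      = t * (\<Sum>\<rho>\<in>R. (A \<rho> $ j)\<^sup>2)" for j
  proof -
    have "(\<Sum>\<rho>\<in>R. \<Sum>\<sigma>\<in>R. t * (if j = l \<and> \<rho> = \<sigma> then 1 else 0) * A \<rho> $ j * A \<sigma> $ l)
        = (if j = l then t * (\<Sum>\<rho>\<in>R. (A \<rho> $ j)\<^sup>2) else 0)" for l
    proof (cases "j = l")
      case True
      have "(\<Sum>\<sigma>\<in>R. t * (if j = l \<and> \<rho> = \<sigma> then 1 else 0) * A \<rho> $ j * A \<sigma> $ l)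
          = t * (A \<rho> $ j)\<^sup>2" if "\<rho> \<in> R" for \<rho>
      proof -
        have "(\<Sum>\<sigma>\<in>R. t * (if j = l \<and> \<rho> = \<sigma> then 1 else 0) * A \<rho> $ j * A \<sigma> $ l)
            = (\<Sum>\<sigma>\<in>R. if \<rho> = \<sigma> then t * (A \<rho> $ j)\<^sup>2 else 0)"
          using True by (intro sum.cong refl) (auto simp: power2_eq_square)
        then show ?thesis
          using assms that by simp
      qed
      with True show ?thesis
        by (simp add: sum_distrib_left)
    qed simp
    then show ?thesis
      by simp
  qed
  then show ?thesis
    by (simp add: tensor_form_def columns_norm_sq_def left_diff_distrib sum_subtractf sum_distrib_left)
qed

text \<open>The nonnegativity result is applied to \<open>K\<close> minus \<open>t\<close> times the
  identity; on outer products this shift lowers the symbol by exactly the left-hand side of the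
  assumed bound.\<close>

lemma sum_tensor_form_coercive:
  fixes u :: "real ^ 'd \<Rightarrow> real ^ 'd"
  assumes "finite R" and R: "R = uminus ` R"
    and K: "\<forall>j l. \<forall>\<rho>\<in>R. \<forall>\<sigma>\<in>R. K j \<rho> l \<sigma> = K j (- \<rho>) l (- \<sigma>)"
    and symbol: "\<And>\<xi> k. t * ((norm \<xi>)\<^sup>2 * ((\<Sum>\<rho>\<in>R. (c_vec k \<rho>)\<^sup>2) + (\<Sum>\<rho>\<in>R. (s_vec k \<rho>)\<^sup>2)))
       \<le> tensor_form R K (outer_columns \<xi> (c_vec k)) (outer_columns \<xi> (c_vec k))
       + tensor_form R K (outer_columns \<xi> (s_vec k)) (outer_columns \<xi> (s_vec k))"
    and T: "finite T" "T \<subseteq> int_lattice"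
    and u0: "\<And>x. u x \<noteq> 0 \<Longrightarrow> x \<in> T"
    and u1: "\<And>x \<rho>. \<rho> \<in> R \<Longrightarrow> u (x + \<rho>) \<noteq> 0 \<Longrightarrow> x \<in> T"
  shows "t * (\<Sum>x\<in>T. columns_norm_sq R (\<lambda>\<rho>. u (x + \<rho>) - u x))
     \<le> (\<Sum>x\<in>T. tensor_form R K (\<lambda>\<rho>. u (x + \<rho>) - u x) (\<lambda>\<rho>. u (x + \<rho>) - u x))"
proof -
  define K' where "K' = (\<lambda>j \<rho> l \<sigma>. K j \<rho> l \<sigma> - t * (if j = l \<and> \<rho> = \<sigma> then 1 else 0))"
  have K'_form: "tensor_form R K' A A = tensor_form R K A A - t * columns_norm_sq R A" for A
    unfolding K'_def by (rule tensor_form_diff_norm [OF assms(1)])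
  have "(\<Sum>x\<in>T. tensor_form R K' (\<lambda>\<rho>. u (x + \<rho>) - u x) (\<lambda>\<rho>. u (x + \<rho>) - u x)) \<ge> 0"
  proof (rule sum_tensor_form_nonneg [OF R _ _ T u0 u1])
    show "\<forall>j l. \<forall>\<rho>\<in>R. \<forall>\<sigma>\<in>R. K' j \<rho> l \<sigma> = K' j (- \<rho>) l (- \<sigma>)"
    proof (intro allI ballI)
      fix j l \<rho> \<sigma> assume "\<rho> \<in> R" "\<sigma> \<in> R"
      then have "K j \<rho> l \<sigma> = K j (- \<rho>) l (- \<sigma>)"
        by (rule K [rule_format])
      then show "K' j \<rho> l \<sigma> = K' j (- \<rho>) l (- \<sigma>)"
        \<comment> \<open>The identity tensor respects the parity condition because negation is
          injective.\<close>
        unfolding K'_def by (simp only: neg_equal_iff_equal)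
    qed
    show "0 \<le> tensor_form R K' (outer_columns \<xi> (c_vec k)) (outer_columns \<xi> (c_vec k))
       + tensor_form R K' (outer_columns \<xi> (s_vec k)) (outer_columns \<xi> (s_vec k))" for \<xi> k
      using symbol [of \<xi> k] by (simp add: K'_form columns_norm_sq_outer algebra_simps)
  qed
  then show ?thesis
    by (simp add: K'_form sum_subtractf sum_distrib_left)
qed

section \<open>Lower bound for the symbol\<close>

text \<open>Taylor's formula gives the constant 1/6; only the cubic order matters below.\<close>

lemma abs_sin_diff_self_le: "\<bar>sin x - x\<bar> \<le> \<bar>x\<bar> ^ 3" for x :: real
proof -
  have "\<bar>sin x - x\<bar> \<le> inverse (fact 3) * \<bar>x\<bar> ^ 3"
    using Maclaurin_sin_bound [of x 3] by (simp add: eval_nat_numeral sin_coeff_def)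
  also have "\<dots> \<le> 1 * \<bar>x\<bar> ^ 3"
    by (intro mult_right_mono) (simp_all add: eval_nat_numeral)
  finally show ?thesis by simp
qed

text \<open>Entrywise estimate, meant for the error terms when \<open>s_vec\<close> is replaced by
  its linearisation.\<close>

lemma tensor_form_outer_le:
  assumes b: "\<And>\<rho>. \<rho> \<in> R \<Longrightarrow> \<bar>b \<rho>\<bar> \<le> B" and b': "\<And>\<rho>. \<rho> \<in> R \<Longrightarrow> \<bar>b' \<rho>\<bar> \<le> B'"
  shows "\<bar>tensor_form R K (outer_columns \<xi> b) (outer_columns \<xi> b')\<bar>
     \<le> (\<Sum>j\<in>UNIV. \<Sum>l\<in>UNIV. \<Sum>\<rho>\<in>R. \<Sum>\<sigma>\<in>R. \<bar>K j \<rho> l \<sigma>\<bar>) * ((norm \<xi>)\<^sup>2 * (B * B'))"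
proof -
  have "\<bar>tensor_form R K (outer_columns \<xi> b) (outer_columns \<xi> b')\<bar>
      \<le> (\<Sum>j\<in>UNIV. \<Sum>l\<in>UNIV. \<Sum>\<rho>\<in>R. \<Sum>\<sigma>\<in>R. \<bar>K j \<rho> l \<sigma> * (\<xi> $ j * b \<rho>) * (\<xi> $ l * b' \<sigma>)\<bar>)"
    unfolding tensor_form_def outer_columns_def vec_lambda_beta
    by (intro order_trans [OF sum_abs] sum_mono order.refl)
  also have "\<dots> \<le> (\<Sum>j\<in>UNIV. \<Sum>l\<in>UNIV. \<Sum>\<rho>\<in>R. \<Sum>\<sigma>\<in>R. \<bar>K j \<rho> l \<sigma>\<bar> * ((norm \<xi>)\<^sup>2 * (B * B')))"
  proof (intro sum_mono)
    fix j l \<rho> \<sigma> assume rs: "\<rho> \<in> R" "\<sigma> \<in> R"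
    have "B \<ge> 0"
      using b [OF rs(1)] by linarith
    have "\<bar>\<xi> $ j * b \<rho>\<bar> * \<bar>\<xi> $ l * b' \<sigma>\<bar> \<le> (norm \<xi> * B) * (norm \<xi> * B')"
      unfolding abs_mult
      by (intro mult_mono component_le_norm_cart b b' rs mult_nonneg_nonneg abs_ge_zero norm_ge_zero \<open>B \<ge> 0\<close>)
    then have "\<bar>K j \<rho> l \<sigma>\<bar> * (\<bar>\<xi> $ j * b \<rho>\<bar> * \<bar>\<xi> $ l * b' \<sigma>\<bar>)
        \<le> \<bar>K j \<rho> l \<sigma>\<bar> * ((norm \<xi> * B) * (norm \<xi> * B'))"
      by (rule mult_left_mono) simp
    then show "\<bar>K j \<rho> l \<sigma> * (\<xi> $ j * b \<rho>) * (\<xi> $ l * b' \<sigma>)\<bar> \<le> \<bar>K j \<rho> l \<sigma>\<bar> * ((norm \<xi>)\<^sup>2 * (B * B'))"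
      by (simp add: abs_mult power2_eq_square mult_ac)
  qed
  finally show ?thesis
    by (simp only: sum_distrib_right)
qed

text \<open>The matrix \<open>outer_matrix \<xi> \<eta>\<close> sends \<open>\<rho>\<close> to
  \<open>\<xi>\<close> scaled by \<open>\<rho> \<bullet> \<eta>\<close>. The Legendre-Hadamard form
  thus sees the linearisation of \<open>s_vec\<close> at the origin.\<close>

lemma LH_form_outer:
  "LH_form R K (outer_matrix \<xi> \<eta>) (outer_matrix \<xi> \<eta>)
   = tensor_form R K (outer_columns \<xi> (\<lambda>\<rho>. \<rho> \<bullet> \<eta>)) (outer_columns \<xi> (\<lambda>\<rho>. \<rho> \<bullet> \<eta>))"
proof -
  have "outer_matrix \<xi> \<eta> *v \<rho> = outer_columns \<xi> (\<lambda>\<rho>. \<rho> \<bullet> \<eta>) \<rho>" for \<rho>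
    by (simp add: vec_eq_iff outer_matrix_def outer_columns_def matrix_vector_mult_def inner_vec_def
        sum_distrib_left mult_ac)
  then show ?thesis
    by (simp add: LH_form_def)
qed

text \<open>Any real \<open>\<mu>\<close> strictly between 0 and the extended-real infimum serves as
  the constant.\<close>

lemma lambda_LH_pos_coercive:
  assumes "lambda_LH R K > 0"
  obtains \<mu> where "\<mu> > 0"
    and "\<And>\<xi> \<eta>. \<mu> * ((norm \<xi>)\<^sup>2 * (norm \<eta>)\<^sup>2)
      \<le> tensor_form R K (outer_columns \<xi> (\<lambda>\<rho>. \<rho> \<bullet> \<eta>)) (outer_columns \<xi> (\<lambda>\<rho>. \<rho> \<bullet> \<eta>))"
proof -
  obtain \<mu> where \<mu>: "0 < ereal \<mu>" "ereal \<mu> < lambda_LH R K"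
    using assms ereal_dense2 by blast
  have "\<mu> * ((norm \<xi>)\<^sup>2 * (norm \<eta>)\<^sup>2)
      \<le> tensor_form R K (outer_columns \<xi> (\<lambda>\<rho>. \<rho> \<bullet> \<eta>)) (outer_columns \<xi> (\<lambda>\<rho>. \<rho> \<bullet> \<eta>))" for \<xi> \<eta>
  proof (cases "\<xi> = 0 \<or> \<eta> = 0")
    case True
    \<comment> \<open>The infimum omits zero vectors, but there both sides are 0.\<close>
    then show ?thesis
      by (auto simp: tensor_form_def outer_columns_def)
  next
    case False
    have "lambda_LH R K \<le> ereal (LH_form R K (outer_matrix \<xi> \<eta>) (outer_matrix \<xi> \<eta>) / ((norm \<xi>)\<^sup>2 * (norm \<eta>)\<^sup>2))"
      unfolding lambda_LH_def using False by (intro INF_lower2 [of \<xi>] INF_lower2 [of \<eta>]) auto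
    with \<mu> have "ereal \<mu> < ereal (LH_form R K (outer_matrix \<xi> \<eta>) (outer_matrix \<xi> \<eta>) / ((norm \<xi>)\<^sup>2 * (norm \<eta>)\<^sup>2))"
      by (rule_tac less_le_trans)
    then show ?thesis
      using False by (simp add: LH_form_outer field_simps)
  qed
  with \<mu> show ?thesis
    using that by simp
qed

text \<open>Replacing \<open>sin (\<rho> \<bullet> k)\<close> by \<open>\<rho> \<bullet> k\<close>
  costs a term of fourth order in \<open>k\<close>, which for small \<open>k\<close> is absorbed by
  half of the quadratic Legendre-Hadamard bound.\<close>

lemma tensor_form_sin_near_zero:
  fixes R :: "(real ^ 'd) set"
  assumes "finite R" and "\<mu> > 0"
    and LH: "\<And>\<xi> \<eta>. \<mu> * ((norm \<xi>)\<^sup>2 * (norm \<eta>)\<^sup>2)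
      \<le> tensor_form R K (outer_columns \<xi> (\<lambda>\<rho>. \<rho> \<bullet> \<eta>)) (outer_columns \<xi> (\<lambda>\<rho>. \<rho> \<bullet> \<eta>))"
  obtains \<delta> where "\<delta> > 0"
    and "\<And>\<xi> k. norm k \<le> \<delta> \<Longrightarrow> \<mu> / 2 * ((norm \<xi>)\<^sup>2 * (norm k)\<^sup>2)
      \<le> tensor_form R K (outer_columns \<xi> (s_vec k)) (outer_columns \<xi> (s_vec k))"
proof -
  define C where "C = (\<Sum>j\<in>UNIV. \<Sum>l\<in>UNIV. \<Sum>\<rho>\<in>R. \<Sum>\<sigma>\<in>R. \<bar>K j \<rho> l \<sigma>\<bar>)"
  define P where "P = (\<Sum>\<rho>\<in>R. norm \<rho>)"
  have "C \<ge> 0" "P \<ge> 0"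
    by (auto simp: C_def P_def intro!: sum_nonneg)
  \<comment> \<open>Two error terms of size \<open>E\<close> must fit into half of the lower bound,
    which needs \<open>4 * C * P ^ 4 * (norm k)\<^sup>2 \<le> \<mu>\<close>. The added 1 keeps the
    divisor positive.\<close>
  define M where "M = 4 * C * P ^ 4 + 1"
  have "M > 0"
    using \<open>C \<ge> 0\<close> \<open>P \<ge> 0\<close> by (simp add: M_def add_nonneg_pos)
  have P: "\<bar>\<rho> \<bullet> k\<bar> \<le> P * norm k" if "\<rho> \<in> R" for \<rho> k
  proof -
    have "norm \<rho> \<le> P"
      unfolding P_def using assms(1) that by (intro member_le_sum) auto
    then show ?thesis
      by (meson Cauchy_Schwarz_ineq2 mult_right_mono norm_ge_zero order_trans)
  qed
  show ?thesis
  proof (rule that [of "sqrt (\<mu> / M)"])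
    show "sqrt (\<mu> / M) > 0"
      using \<open>\<mu> > 0\<close> \<open>M > 0\<close> by simp
    fix \<xi> k :: "real ^ 'd" assume k: "norm k \<le> sqrt (\<mu> / M)"
    let ?l = "\<lambda>\<rho>. \<rho> \<bullet> k"
    define r where "r = (\<lambda>\<rho>. s_vec k \<rho> - \<rho> \<bullet> k)"
    define B where "B = P * norm k"
    have l: "\<bar>\<rho> \<bullet> k\<bar> \<le> B" and s: "\<bar>s_vec k \<rho>\<bar> \<le> B" and r: "\<bar>r \<rho>\<bar> \<le> B ^ 3" if "\<rho> \<in> R" for \<rho>
    proof -
      show l: "\<bar>\<rho> \<bullet> k\<bar> \<le> B"
        using P [OF that] by (simp add: B_def)
      show "\<bar>s_vec k \<rho>\<bar> \<le> B"
        unfolding s_vec_def using abs_sin_x_le_abs_x l by (rule order_trans)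
      have "\<bar>r \<rho>\<bar> \<le> \<bar>\<rho> \<bullet> k\<bar> ^ 3"
        unfolding r_def s_vec_def by (rule abs_sin_diff_self_le)
      also have "\<dots> \<le> B ^ 3"
        using l by (intro power_mono) auto
      finally show "\<bar>r \<rho>\<bar> \<le> B ^ 3" .
    qed
    have s_eq: "outer_columns \<xi> (s_vec k) = (\<lambda>\<rho>. outer_columns \<xi> ?l \<rho> + outer_columns \<xi> r \<rho>)"
      by (simp add: fun_eq_iff vec_eq_iff outer_columns_def r_def algebra_simps)
    \<comment> \<open>With s = l + r, the left slot is split first and the right slot only in the
      term with \<open>l\<close>. This leaves two errors, both of order
      \<open>B ^ 4\<close>.\<close>
    have expand: "tensor_form R K (outer_columns \<xi> (s_vec k)) (outer_columns \<xi> (s_vec k))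
        = tensor_form R K (outer_columns \<xi> ?l) (outer_columns \<xi> ?l)
        + tensor_form R K (outer_columns \<xi> ?l) (outer_columns \<xi> r)
        + tensor_form R K (outer_columns \<xi> r) (outer_columns \<xi> (s_vec k))"
    proof -
      have "tensor_form R K (outer_columns \<xi> (s_vec k)) (outer_columns \<xi> (s_vec k))
          = tensor_form R K (outer_columns \<xi> ?l) (outer_columns \<xi> (s_vec k))
          + tensor_form R K (outer_columns \<xi> r) (outer_columns \<xi> (s_vec k))"
        by (subst (1) s_eq) (rule tensor_form_add_left)
      moreover have "tensor_form R K (outer_columns \<xi> ?l) (outer_columns \<xi> (s_vec k))
          = tensor_form R K (outer_columns \<xi> ?l) (outer_columns \<xi> ?l)
          + tensor_form R K (outer_columns \<xi> ?l) (outer_columns \<xi> r)"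
        by (subst s_eq) (rule tensor_form_add_right)
      ultimately show ?thesis
        by linarith
    qed
    define E where "E = C * ((norm \<xi>)\<^sup>2 * B ^ 4)"
    have E1: "C * ((norm \<xi>)\<^sup>2 * (B * B ^ 3)) = E" and E2: "C * ((norm \<xi>)\<^sup>2 * (B ^ 3 * B)) = E"
      by (simp_all add: E_def eval_nat_numeral mult_ac)
    have lr: "\<bar>tensor_form R K (outer_columns \<xi> ?l) (outer_columns \<xi> r)\<bar> \<le> C * ((norm \<xi>)\<^sup>2 * (B * B ^ 3))"
      unfolding C_def by (rule tensor_form_outer_le) (use l r in auto)
    have rs: "\<bar>tensor_form R K (outer_columns \<xi> r) (outer_columns \<xi> (s_vec k))\<bar> \<le> C * ((norm \<xi>)\<^sup>2 * (B ^ 3 * B))"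
      unfolding C_def by (rule tensor_form_outer_le) (use s r in auto)
    have "(norm k)\<^sup>2 \<le> \<mu> / M"
      using k \<open>\<mu> > 0\<close> \<open>M > 0\<close> by (metis divide_pos_pos less_imp_le norm_ge_zero power_mono real_sqrt_pow2)
    then have "M * (norm k)\<^sup>2 \<le> \<mu>"
      using \<open>M > 0\<close> by (simp add: field_simps)
    then have "4 * C * P ^ 4 * (norm k)\<^sup>2 \<le> \<mu>"
      unfolding M_def distrib_right by (smt (verit) zero_le_power2)
    then have "4 * C * P ^ 4 * (norm k)\<^sup>2 * ((norm \<xi>)\<^sup>2 * (norm k)\<^sup>2) \<le> \<mu> * ((norm \<xi>)\<^sup>2 * (norm k)\<^sup>2)"
      by (intro mult_right_mono) auto
    also have "4 * C * P ^ 4 * (norm k)\<^sup>2 * ((norm \<xi>)\<^sup>2 * (norm k)\<^sup>2)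
        = 4 * E"
      by (simp add: E_def B_def power_mult_distrib eval_nat_numeral algebra_simps)
    finally show "\<mu> / 2 * ((norm \<xi>)\<^sup>2 * (norm k)\<^sup>2)
        \<le> tensor_form R K (outer_columns \<xi> (s_vec k)) (outer_columns \<xi> (s_vec k))"
      using abs_le_D2 [OF lr] abs_le_D2 [OF rs] expand LH [of \<xi> k] unfolding E1 E2 by linarith
  qed
qed

section \<open>The symbol away from the origin\<close>

text \<open>Rounding each coordinate of \<open>k / (2 * pi)\<close> to the nearest integer changes
  \<open>\<rho> \<bullet> k\<close> by a multiple of 2 pi when \<open>\<rho>\<close> is
  integral.\<close>

lemma frequency_reduction:
  fixes k :: "real ^ 'd"
  obtains k' where "\<And>i. \<bar>k' $ i\<bar> \<le> pi"
    and "\<And>\<rho>. \<rho> \<in> int_lattice \<Longrightarrow> cos (\<rho> \<bullet> k') = cos (\<rho> \<bullet> k)"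
    and "\<And>\<rho>. \<rho> \<in> int_lattice \<Longrightarrow> sin (\<rho> \<bullet> k') = sin (\<rho> \<bullet> k)"
proof -
  define n :: "'d \<Rightarrow> int" where "n i = round (k $ i / (2 * pi))" for i
  define k' :: "real ^ 'd" where "k' = (\<chi> i. k $ i - 2 * pi * of_int (n i))"
  have "\<bar>k' $ i\<bar> \<le> pi" for i
  proof -
    have "\<bar>of_int (n i) - k $ i / (2 * pi)\<bar> \<le> 1 / 2"
      unfolding n_def by (rule of_int_round_abs_le)
    then have "2 * pi * \<bar>of_int (n i) - k $ i / (2 * pi)\<bar> \<le> 2 * pi * (1 / 2)"
      by (intro mult_left_mono) auto
    also have "2 * pi * \<bar>of_int (n i) - k $ i / (2 * pi)\<bar> = \<bar>2 * pi * (of_int (n i) - k $ i / (2 * pi))\<bar>"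
      by (simp add: abs_mult)
    finally show ?thesis
      by (simp add: k'_def right_diff_distrib abs_minus_commute)
  qed
  moreover have "\<exists>m::int. \<rho> \<bullet> k = \<rho> \<bullet> k' + 2 * pi * of_int m" if "\<rho> \<in> int_lattice" for \<rho>
  proof -
    have "(\<Sum>i\<in>UNIV. \<rho> $ i * of_int (n i)) \<in> \<int>"
      using that by (intro Ints_sum Ints_mult) (auto simp: int_lattice_def)
    then obtain m where m: "(\<Sum>i\<in>UNIV. \<rho> $ i * of_int (n i)) = real_of_int m"
      by (auto elim: Ints_cases)
    have "\<rho> \<bullet> k = \<rho> \<bullet> k' + 2 * pi * (\<Sum>i\<in>UNIV. \<rho> $ i * of_int (n i))"
      by (simp add: k'_def inner_vec_def sum_distrib_left sum.distrib [symmetric] algebra_simps)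
    with m show ?thesis by auto
  qed
  then have "cos (\<rho> \<bullet> k') = cos (\<rho> \<bullet> k)" "sin (\<rho> \<bullet> k') = sin (\<rho> \<bullet> k)" if "\<rho> \<in> int_lattice" for \<rho>
    using that by (metis cos_add cos_int_2pin sin_int_2pin mult_1_right mult_zero_right diff_zero,
        metis sin_add cos_int_2pin sin_int_2pin mult_1_right mult_zero_right add_0_right)
  ultimately show ?thesis
    using that by blast
qed

text \<open>The vectors whose product with \<open>k\<close> lies in 2 pi times the integers form a
  submodule. It contains \<open>R\<close>, hence the whole lattice and in particular the unit
  vectors, so each coordinate of \<open>k\<close> is a multiple of 2 pi of modulus at most
  pi.\<close>

lemma frequency_eq_zero:
  fixes k :: "real ^ 'd"
  assumes "int_span R = int_lattice" and "\<And>\<rho>. \<rho> \<in> R \<Longrightarrow> cos (\<rho> \<bullet> k) = 1"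
    and "\<And>i. \<bar>k $ i\<bar> \<le> pi"
  shows "k = 0"
proof -
  define V where "V = {v. \<exists>n::int. v \<bullet> k = of_int n * 2 * pi}"
  have "int_module.subspace V"
  proof (rule int_module.subspaceI)
    show "0 \<in> V"
      by (auto simp: V_def intro: exI [of _ 0])
    show "x + y \<in> V" if "x \<in> V" "y \<in> V" for x y
    proof -
      from that obtain m n :: int where "x \<bullet> k = of_int m * 2 * pi" "y \<bullet> k = of_int n * 2 * pi"
        by (auto simp: V_def)
      then have "(x + y) \<bullet> k = of_int (m + n) * 2 * pi"
        by (simp add: inner_add_left algebra_simps)
      then show ?thesis
        unfolding V_def by blast
    qed
    show "of_int c *\<^sub>R x \<in> V" if "x \<in> V" for c x
    proof -
      from that obtain m :: int where "x \<bullet> k = of_int m * 2 * pi"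
        by (auto simp: V_def)
      then have "(of_int c *\<^sub>R x) \<bullet> k = of_int (c * m) * 2 * pi"
        by simp
      then show ?thesis
        unfolding V_def by blast
    qed
  qed
  moreover have "R \<subseteq> V"
    using assms(2) by (auto simp: V_def cos_one_2pi_int)
  ultimately have V: "int_lattice \<subseteq> V"
    using int_module.span_minimal assms(1) unfolding int_span_def by blast
  have "k $ i = 0" for i
  proof -
    have "axis i 1 \<in> int_lattice"
      by (auto simp: int_lattice_def axis_def)
    with V have "axis i 1 \<in> V" ..
    then obtain n :: int where n: "k $ i = of_int n * 2 * pi"
      by (auto simp: V_def inner_axis')
    with assms(3) [of i] have "\<bar>real_of_int n\<bar> * 2 \<le> 1"
      by (simp add: abs_mult)
    then have "n = 0"
      by linarith
    with n show ?thesis by simp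
  qed
  then show ?thesis
    by (simp add: vec_eq_iff)
qed

text \<open>A continuous function attains its minimum on the closed box minus an open ball, and the
  spanning property makes that minimum positive.\<close>

lemma c_vec_norm_lower_bound:
  fixes R :: "(real ^ 'd) set"
  assumes "finite R" and "int_span R = int_lattice" and "\<delta> > 0"
  obtains m where "m > 0"
    and "\<And>k. (\<And>i. \<bar>k $ i\<bar> \<le> pi) \<Longrightarrow> \<delta> \<le> norm k \<Longrightarrow> m \<le> (\<Sum>\<rho>\<in>R. (c_vec k \<rho>)\<^sup>2)"
proof -
  define S :: "(real ^ 'd) set" where "S = cbox (\<chi> i. - pi) (\<chi> i. pi) - ball 0 \<delta>"
  have S_iff: "k \<in> S \<longleftrightarrow> (\<forall>i. \<bar>k $ i\<bar> \<le> pi) \<and> \<delta> \<le> norm k" for k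
    unfolding S_def abs_le_iff minus_le_iff [of _ pi] by (auto simp: mem_box_cart)
  show ?thesis
  proof (cases "S = {}")
    case True
    \<comment> \<open>If the ball swallows the box, no \<open>k\<close> qualifies and any positive
      \<open>m\<close> will do.\<close>
    then show ?thesis
      using that [of 1] S_iff by auto
  next
    case False
    have "compact S"
      unfolding S_def by (intro compact_diff compact_cbox open_ball)
    moreover have "continuous_on S (\<lambda>k. \<Sum>\<rho>\<in>R. (c_vec k \<rho>)\<^sup>2)"
      unfolding c_vec_def by (intro continuous_intros)
    ultimately obtain k0 where k0: "k0 \<in> S"
      and min: "\<And>k. k \<in> S \<Longrightarrow> (\<Sum>\<rho>\<in>R. (c_vec k0 \<rho>)\<^sup>2) \<le> (\<Sum>\<rho>\<in>R. (c_vec k \<rho>)\<^sup>2)"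
      using continuous_attains_inf False by meson
    have "(\<Sum>\<rho>\<in>R. (c_vec k0 \<rho>)\<^sup>2) \<noteq> 0"
    proof
      assume "(\<Sum>\<rho>\<in>R. (c_vec k0 \<rho>)\<^sup>2) = 0"
      then have "cos (\<rho> \<bullet> k0) = 1" if "\<rho> \<in> R" for \<rho>
        using that assms(1) by (simp add: sum_nonneg_eq_0_iff c_vec_def)
      then have "k0 = 0"
        using frequency_eq_zero assms(2) k0 S_iff by blast
      with k0 \<open>\<delta> > 0\<close> show False
        by (simp add: S_iff)
    qed
    then have "(\<Sum>\<rho>\<in>R. (c_vec k0 \<rho>)\<^sup>2) > 0"
      by (simp add: less_le sum_nonneg)
    with min show ?thesis
      using that S_iff by blast
  qed
qed

text \<open>Near the origin \<open>c(k)\<close> is only quadratic in \<open>k\<close>, and the Legendre-Hadamard condition controls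
  \<open>s(k)\<close>; away from the points of \<open>2\<pi>\<int>\<^sup>d\<close> the norm of \<open>c(k)\<close> is bounded below and dominates \<open>s(k)\<close>.\<close>

lemma symbol_coercive:
  fixes R :: "(real ^ 'd) set"
  assumes "finite R" and "R \<subseteq> int_lattice" and "int_span R = int_lattice"
    and "lambda_LH R K > 0"
    and s: "\<And>\<xi> k. tensor_form R K (outer_columns \<xi> (s_vec k)) (outer_columns \<xi> (s_vec k)) \<ge> 0"
    and "\<gamma> > 0"
    and c: "\<And>\<xi> k. tensor_form R K (outer_columns \<xi> (c_vec k)) (outer_columns \<xi> (c_vec k))
                 \<ge> \<gamma> * (norm \<xi>)\<^sup>2 * (\<Sum>\<rho>\<in>R. (c_vec k \<rho>)\<^sup>2)"
  obtains t where "t > 0"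
    and "\<And>\<xi> k. t * ((norm \<xi>)\<^sup>2 * ((\<Sum>\<rho>\<in>R. (c_vec k \<rho>)\<^sup>2) + (\<Sum>\<rho>\<in>R. (s_vec k \<rho>)\<^sup>2)))
       \<le> tensor_form R K (outer_columns \<xi> (c_vec k)) (outer_columns \<xi> (c_vec k))
       + tensor_form R K (outer_columns \<xi> (s_vec k)) (outer_columns \<xi> (s_vec k))"
proof -
  obtain \<mu> where \<mu>: "\<mu> > 0"
    and LH: "\<And>\<xi> \<eta>. \<mu> * ((norm \<xi>)\<^sup>2 * (norm \<eta>)\<^sup>2)
      \<le> tensor_form R K (outer_columns \<xi> (\<lambda>\<rho>. \<rho> \<bullet> \<eta>)) (outer_columns \<xi> (\<lambda>\<rho>. \<rho> \<bullet> \<eta>))"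
    using lambda_LH_pos_coercive [OF assms(4)] by blast
  obtain \<delta> where \<delta>: "\<delta> > 0"
    and near: "\<And>\<xi> k. norm k \<le> \<delta> \<Longrightarrow> \<mu> / 2 * ((norm \<xi>)\<^sup>2 * (norm k)\<^sup>2)
      \<le> tensor_form R K (outer_columns \<xi> (s_vec k)) (outer_columns \<xi> (s_vec k))"
    using tensor_form_sin_near_zero [OF assms(1) \<mu> LH] by blast
  obtain m where m: "m > 0"
    and far: "\<And>k. (\<And>i. \<bar>k $ i\<bar> \<le> pi) \<Longrightarrow> \<delta> \<le> norm k \<Longrightarrow> m \<le> (\<Sum>\<rho>\<in>R. (c_vec k \<rho>)\<^sup>2)"
    using c_vec_norm_lower_bound [OF assms(1,3) \<delta>] by blast
  \<comment> \<open>\<open>Q\<close> is chosen so that the squared norm of s(k) is at most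
    \<open>Q * (norm k)\<^sup>2\<close>; the 1 makes it positive.\<close>
  define Q where "Q = (\<Sum>\<rho>\<in>R. (norm \<rho>)\<^sup>2) + 1"
  have "Q > 0"
    unfolding Q_def by (intro add_nonneg_pos sum_nonneg) auto
  define n where "n = real (card R)"
  \<comment> \<open>The first two entries serve small \<open>k\<close>, for the cosine and sine
    parts separately. The third serves large \<open>k\<close>, where the squared norm of s(k) is at
    most \<open>n\<close>, hence at most \<open>n / m\<close> times that of c(k).\<close>
  define t where "t = Min {\<gamma>, \<mu> / (2 * Q), \<gamma> / (1 + n / m)}"
  have pos: "0 < 1 + n / m"
    using m by (simp add: n_def add_pos_nonneg)
  have t: "t > 0" "t \<le> \<gamma>" "t \<le> \<mu> / (2 * Q)" "t \<le> \<gamma> / (1 + n / m)"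
    unfolding t_def using \<open>\<gamma> > 0\<close> \<mu> \<open>Q > 0\<close> pos by (simp_all add: min_def)
  have tQ: "t * Q \<le> \<mu> / 2"
    using t(3) \<open>Q > 0\<close> by (simp add: field_simps)
  have tn: "t * (1 + n / m) \<le> \<gamma>"
    using t(4) pos by (simp only: pos_le_divide_eq)
  have reduced: "t * ((norm \<xi>)\<^sup>2 * ((\<Sum>\<rho>\<in>R. (c_vec k \<rho>)\<^sup>2) + (\<Sum>\<rho>\<in>R. (s_vec k \<rho>)\<^sup>2)))
       \<le> tensor_form R K (outer_columns \<xi> (c_vec k)) (outer_columns \<xi> (c_vec k))
       + tensor_form R K (outer_columns \<xi> (s_vec k)) (outer_columns \<xi> (s_vec k))"
    if k: "\<And>i. \<bar>k $ i\<bar> \<le> pi" for \<xi> k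
  proof -
    define c2 where "c2 = (\<Sum>\<rho>\<in>R. (c_vec k \<rho>)\<^sup>2)"
    define s2 where "s2 = (\<Sum>\<rho>\<in>R. (s_vec k \<rho>)\<^sup>2)"
    have "c2 \<ge> 0"
      by (simp add: c2_def sum_nonneg)
    have c_ge: "\<gamma> * ((norm \<xi>)\<^sup>2 * c2) \<le> tensor_form R K (outer_columns \<xi> (c_vec k)) (outer_columns \<xi> (c_vec k))"
      using c [where k = k and \<xi> = \<xi>] by (simp add: c2_def mult.assoc)
    show ?thesis
    proof (cases "norm k \<le> \<delta>")
      case True
      have "s2 \<le> (\<Sum>\<rho>\<in>R. (norm \<rho>)\<^sup>2 * (norm k)\<^sup>2)"
        unfolding s2_def
      proof (rule sum_mono)
        fix \<rho>
        have "\<bar>s_vec k \<rho>\<bar> \<le> norm \<rho> * norm k"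
          unfolding s_vec_def using abs_sin_x_le_abs_x Cauchy_Schwarz_ineq2 by (rule order_trans)
        then show "(s_vec k \<rho>)\<^sup>2 \<le> (norm \<rho>)\<^sup>2 * (norm k)\<^sup>2"
          by (metis abs_ge_zero power2_abs power_mono power_mult_distrib)
      qed
      also have "\<dots> \<le> Q * (norm k)\<^sup>2"
        by (simp add: Q_def sum_distrib_right [symmetric] distrib_right)
      finally have "t * s2 \<le> t * (Q * (norm k)\<^sup>2)"
        using t(1) by simp
      also have "\<dots> \<le> \<mu> / 2 * (norm k)\<^sup>2"
        unfolding mult.assoc [symmetric] using tQ by (rule mult_right_mono) simp
      finally have "(norm \<xi>)\<^sup>2 * (t * s2) \<le> (norm \<xi>)\<^sup>2 * (\<mu> / 2 * (norm k)\<^sup>2)"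
        by (rule mult_left_mono) simp
      also have "\<dots> = \<mu> / 2 * ((norm \<xi>)\<^sup>2 * (norm k)\<^sup>2)"
        by simp
      also have "\<dots> \<le> tensor_form R K (outer_columns \<xi> (s_vec k)) (outer_columns \<xi> (s_vec k))"
        by (rule near [OF True])
      finally have s_ge: "(norm \<xi>)\<^sup>2 * (t * s2) \<le> tensor_form R K (outer_columns \<xi> (s_vec k)) (outer_columns \<xi> (s_vec k))" .
      have "t * ((norm \<xi>)\<^sup>2 * c2) \<le> \<gamma> * ((norm \<xi>)\<^sup>2 * c2)"
        using t(2) \<open>c2 \<ge> 0\<close> by (intro mult_right_mono) auto
      with c_ge s_ge show ?thesis
        by (simp add: c2_def s2_def algebra_simps)
    next
      case False
      then have "m \<le> c2"
        unfolding c2_def using far k by simp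
      have "s2 \<le> (\<Sum>\<rho>\<in>R. 1)"
        unfolding s2_def s_vec_def by (intro sum_mono) (simp add: abs_square_le_1)
      then have "s2 \<le> n / m * m"
        using m by (simp add: n_def)
      also have "\<dots> \<le> n / m * c2"
        using \<open>m \<le> c2\<close> m by (intro mult_left_mono) (auto simp: n_def)
      finally have "c2 + s2 \<le> (1 + n / m) * c2"
        by (simp add: distrib_right)
      then have "t * (c2 + s2) \<le> t * ((1 + n / m) * c2)"
        using t(1) by simp
      also have "\<dots> \<le> \<gamma> * c2"
        unfolding mult.assoc [symmetric] using tn \<open>c2 \<ge> 0\<close> by (rule mult_right_mono)
      finally have "(norm \<xi>)\<^sup>2 * (t * (c2 + s2)) \<le> (norm \<xi>)\<^sup>2 * (\<gamma> * c2)"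
        by (rule mult_left_mono) simp
      with c_ge s [where k = k and \<xi> = \<xi>] show ?thesis
        by (simp add: c2_def s2_def algebra_simps)
    qed
  qed
  \<comment> \<open>Both sides depend on \<open>k\<close> only through
    \<open>cos (\<rho> \<bullet> k)\<close> and \<open>sin (\<rho> \<bullet> k)\<close> with
    integral \<open>\<rho>\<close>, so \<open>k\<close> may be moved into the box.\<close>
  have "t * ((norm \<xi>)\<^sup>2 * ((\<Sum>\<rho>\<in>R. (c_vec k \<rho>)\<^sup>2) + (\<Sum>\<rho>\<in>R. (s_vec k \<rho>)\<^sup>2)))
       \<le> tensor_form R K (outer_columns \<xi> (c_vec k)) (outer_columns \<xi> (c_vec k))
       + tensor_form R K (outer_columns \<xi> (s_vec k)) (outer_columns \<xi> (s_vec k))" for \<xi> k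
  proof -
    obtain k' where k': "\<And>i. \<bar>k' $ i\<bar> \<le> pi"
      and cs: "\<And>\<rho>. \<rho> \<in> int_lattice \<Longrightarrow> cos (\<rho> \<bullet> k') = cos (\<rho> \<bullet> k)"
        "\<And>\<rho>. \<rho> \<in> int_lattice \<Longrightarrow> sin (\<rho> \<bullet> k') = sin (\<rho> \<bullet> k)"
      using frequency_reduction [of k] by blast
    have cR: "c_vec k' \<rho> = c_vec k \<rho>" and sR: "s_vec k' \<rho> = s_vec k \<rho>" if "\<rho> \<in> R" for \<rho>
      using cs that assms(2) by (auto simp: c_vec_def s_vec_def)
    have "tensor_form R K (outer_columns \<xi> (c_vec k')) (outer_columns \<xi> (c_vec k'))
        = tensor_form R K (outer_columns \<xi> (c_vec k)) (outer_columns \<xi> (c_vec k))"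
      "tensor_form R K (outer_columns \<xi> (s_vec k')) (outer_columns \<xi> (s_vec k'))
        = tensor_form R K (outer_columns \<xi> (s_vec k)) (outer_columns \<xi> (s_vec k))"
      by (rule tensor_form_cong; simp add: outer_columns_def cR sR)+
    moreover have "(\<Sum>\<rho>\<in>R. (c_vec k' \<rho>)\<^sup>2) = (\<Sum>\<rho>\<in>R. (c_vec k \<rho>)\<^sup>2)"
      "(\<Sum>\<rho>\<in>R. (s_vec k' \<rho>)\<^sup>2) = (\<Sum>\<rho>\<in>R. (s_vec k \<rho>)\<^sup>2)"
      by (simp_all add: cR sR)
    ultimately show ?thesis
      using reduced [OF k', of \<xi>] by simp
  qed
  with t(1) that show ?thesis
    by blast
qed

section \<open>Admissible functions on the scaled lattice\<close>

lemma finite_bounded_int_lattice: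
  fixes S :: "(real ^ 'd) set"
  assumes "S \<subseteq> int_lattice" and "bounded S"
  shows "finite S"
proof -
  obtain B where B: "\<And>x. x \<in> S \<Longrightarrow> norm x \<le> B"
    using assms(2) bounded_iff by metis
  have "S \<subseteq> (\<lambda>g. \<chi> i. real_of_int (g i)) ` PiE UNIV (\<lambda>_. {- \<lceil>B\<rceil>..\<lceil>B\<rceil>})"
  proof
    fix x assume x: "x \<in> S"
    have "\<bar>x $ i\<bar> \<le> B" for i
      using component_le_norm_cart B [OF x] by (rule order_trans)
    moreover have "x $ i = of_int \<lfloor>x $ i\<rfloor>" for i
      using x assms(1) by (auto simp: int_lattice_def)
    ultimately have "\<bar>\<lfloor>x $ i\<rfloor>\<bar> \<le> \<lceil>B\<rceil>" for i
      by (metis le_of_int_ceiling of_int_abs of_int_le_iff order_trans)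
    then have "(\<lambda>i. \<lfloor>x $ i\<rfloor>) \<in> PiE UNIV (\<lambda>_. {- \<lceil>B\<rceil>..\<lceil>B\<rceil>})"
      by (auto simp: abs_le_iff minus_le_iff)
    moreover have "x = (\<chi> i. of_int \<lfloor>x $ i\<rfloor>)"
      using \<open>\<And>i. x $ i = of_int \<lfloor>x $ i\<rfloor>\<close> by (simp add: vec_eq_iff)
    ultimately show "x \<in> (\<lambda>g. \<chi> i. real_of_int (g i)) ` PiE UNIV (\<lambda>_. {- \<lceil>B\<rceil>..\<lceil>B\<rceil>})"
      by (intro image_eqI [where x = "\<lambda>i. \<lfloor>x $ i\<rfloor>"])
  qed
  then show ?thesis
    by (rule finite_subset) (intro finite_imageI finite_PiE, auto)
qed

text \<open>A segment leaving \<open>\<Omega>\<close> meets the frontier within distance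
  \<open>norm v\<close> of \<open>x\<close>, which is too close. The second claim holds since the
  distance to a set is 1-Lipschitz.\<close>

lemma infdist_frontier_shift:
  fixes \<Omega> :: "(real ^ 'd) set"
  assumes "x \<in> \<Omega>" and "r \<ge> 0" and "infdist x (frontier \<Omega>) > r + norm v"
  shows "x + v \<in> \<Omega>" and "infdist (x + v) (frontier \<Omega>) > r"
proof -
  show "x + v \<in> \<Omega>"
  proof (rule ccontr)
    assume "x + v \<notin> \<Omega>"
    then obtain p where p: "p \<in> closed_segment x (x + v)" "p \<in> frontier \<Omega>"
      using connected_Int_frontier [of "closed_segment x (x + v)" \<Omega>] assms(1) by auto
    have "infdist x (frontier \<Omega>) \<le> dist x p"
      using p(2) by (rule infdist_le)
    also have "\<dots> \<le> norm v"
      using p(1) by (metis add_diff_cancel_left' dist_commute dist_norm segment_bound(1))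
    finally show False
      using assms by linarith
  qed
  have "infdist x (frontier \<Omega>) \<le> infdist (x + v) (frontier \<Omega>) + dist x (x + v)"
    by (rule infdist_triangle)
  then show "infdist (x + v) (frontier \<Omega>) > r"
    using assms by (simp add: dist_norm)
qed

lemma R0_pos: "R0 (R :: (real ^ 'd) set) > 0"
  by (simp add: R0_def less_max_iff_disj)

lemma norm_le_R0: "finite R \<Longrightarrow> \<rho> \<in> R \<Longrightarrow> norm \<rho> \<le> R0 R"
  by (simp add: R0_def le_max_iff_disj)

text \<open>Guarantees that \<open>R\<close> is nonempty in the theorem. The index
  \<open>undefined\<close> stands for an arbitrary coordinate, whose unit vector is a nonzero
  lattice point.\<close>

lemma int_span_empty_ne: "int_span {} \<noteq> (int_lattice :: (real ^ 'd) set)"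
proof
  assume "int_span {} = (int_lattice :: (real ^ 'd) set)"
  then have "axis undefined 1 \<in> ({0} :: (real ^ 'd) set)"
    unfolding int_span_def int_module.span_empty by (auto simp: int_lattice_def axis_def)
  then show False
    by (simp add: axis_eq_0_iff)
qed

lemma columns_norm_sq_scale: "columns_norm_sq R (\<lambda>\<rho>. t *\<^sub>R A \<rho>) = t\<^sup>2 * columns_norm_sq R A"
  by (simp add: columns_norm_sq_def sum_distrib_left power_mult_distrib)

lemma columns_norm_sq_nonneg: "columns_norm_sq R A \<ge> 0"
  by (simp add: columns_norm_sq_def sum_nonneg)

lemma columns_norm_sq_eq_0:
  assumes "finite R" and "columns_norm_sq R A = 0" and "\<rho> \<in> R"
  shows "A \<rho> = 0"
proof -
  have "(\<Sum>\<rho>\<in>R. (A \<rho> $ j)\<^sup>2) = 0" for j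
    using assms(2) unfolding columns_norm_sq_def by (subst (asm) sum_nonneg_eq_0_iff) (auto simp: sum_nonneg)
  then show ?thesis
    using assms(1,3) by (simp add: sum_nonneg_eq_0_iff vec_eq_iff)
qed

text \<open>If all differences vanished, \<open>u\<close> would be constant and nonzero along a ray \<open>z + n\<rho>\<close>.\<close>

lemma sum_columns_norm_sq_pos:
  fixes u :: "real ^ 'd \<Rightarrow> real ^ 'd"
  assumes "finite R" and "\<rho> \<in> R" and "\<rho> \<noteq> 0" and "finite T"
    and u0: "\<And>x. u x \<noteq> 0 \<Longrightarrow> x \<in> T" and "u z \<noteq> 0"
  shows "(\<Sum>x\<in>T. columns_norm_sq R (\<lambda>\<rho>. u (x + \<rho>) - u x)) > 0"
proof (rule ccontr)
  assume "\<not> ?thesis"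
  then have "(\<Sum>x\<in>T. columns_norm_sq R (\<lambda>\<rho>. u (x + \<rho>) - u x)) = 0"
    by (simp add: antisym columns_norm_sq_nonneg not_less sum_nonneg)
  then have "columns_norm_sq R (\<lambda>\<rho>. u (x + \<rho>) - u x) = 0" if "x \<in> T" for x
    using that assms(4) by (simp add: sum_nonneg_eq_0_iff columns_norm_sq_nonneg)
  from columns_norm_sq_eq_0 [OF assms(1) this assms(2)] have step: "u (x + \<rho>) = u x" if "x \<in> T" for x
    using that by simp
  have ray: "u (z + real n *\<^sub>R \<rho>) \<noteq> 0" for n
  proof (induction n)
    case (Suc n)
    have "z + real (Suc n) *\<^sub>R \<rho> = (z + real n *\<^sub>R \<rho>) + \<rho>"
      by (simp add: algebra_simps)
    then show ?case
      using Suc step [OF u0 [OF Suc]] by (simp only: not_False_eq_True)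
  qed (use assms in simp)
  then have "range (\<lambda>n. z + real n *\<^sub>R \<rho>) \<subseteq> T"
    using u0 by blast
  moreover have "inj (\<lambda>n. z + real n *\<^sub>R \<rho>)"
    using assms(3) by (auto simp: inj_on_def)
  ultimately show False
    using assms(4) finite_imageD finite_subset infinite_UNIV_nat by blast
qed

text \<open>The two layer widths do the work: \<open>y\<close> vanishes within
  \<open>2 * \<epsilon> * R0 R\<close> of the frontier while \<open>sint\<close> omits only a layer
  of half that width, and one lattice step in \<open>R\<close> has length at most
  \<open>\<epsilon> * R0 R\<close>.\<close>

lemma admissible_rescale:
  fixes R :: "(real ^ 'd) set"
  assumes "finite R" and "R \<subseteq> int_lattice" and "bounded \<Omega>" and "\<epsilon> > 0"
    and y: "y \<in> admissible R \<epsilon> \<Omega>" "y \<noteq> (\<lambda>x\<in>\<Omega> \<inter> scaled_lattice \<epsilon>. 0)"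
  obtains T u where "finite T" "T \<subseteq> int_lattice"
    and "\<And>x. u x \<noteq> 0 \<Longrightarrow> x \<in> T" and "\<And>x \<rho>. \<rho> \<in> R \<Longrightarrow> u (x + \<rho>) \<noteq> 0 \<Longrightarrow> x \<in> T"
    and "u \<noteq> (\<lambda>_. 0)"
    and "sint R \<epsilon> \<Omega> = (*\<^sub>R) \<epsilon> ` T"
    and "\<And>x \<rho>. x \<in> T \<Longrightarrow> \<rho> \<in> R \<Longrightarrow>
      discrete_grad \<epsilon> y (\<epsilon> *\<^sub>R x) \<rho> = inverse \<epsilon> *\<^sub>R (u (x + \<rho>) - u x)"
proof -
  define T where "T = {z \<in> int_lattice. \<epsilon> *\<^sub>R z \<in> sint R \<epsilon> \<Omega>}"
  \<comment> \<open>Off its domain the extensional \<open>y\<close> takes the value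
    \<open>undefined\<close>, so the extension by zero is explicit.\<close>
  define u where "u z = (if z \<in> int_lattice \<and> \<epsilon> *\<^sub>R z \<in> \<Omega> then y (\<epsilon> *\<^sub>R z) else 0)" for z
  have scaled: "\<epsilon> *\<^sub>R z \<in> scaled_lattice \<epsilon>" if "z \<in> int_lattice" for z
    using that unfolding scaled_lattice_def by (rule imageI)
  have T_iff: "z \<in> T \<longleftrightarrow> z \<in> int_lattice \<and> \<epsilon> *\<^sub>R z \<in> \<Omega> \<and> infdist (\<epsilon> *\<^sub>R z) (frontier \<Omega>) > \<epsilon> * R0 R" for z
    using scaled by (auto simp: T_def sint_def)
  have R0: "\<epsilon> * R0 R > 0"
    using \<open>\<epsilon> > 0\<close> R0_pos by (rule mult_pos_pos)
  have rho: "norm (\<epsilon> *\<^sub>R \<rho>) \<le> \<epsilon> * R0 R" if "\<rho> \<in> R" for \<rho>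
    using norm_le_R0 [OF assms(1) that] \<open>\<epsilon> > 0\<close> by simp
  have supp: "z \<in> int_lattice" "\<epsilon> *\<^sub>R z \<in> \<Omega>" "infdist (\<epsilon> *\<^sub>R z) (frontier \<Omega>) > 2 * \<epsilon> * R0 R"
    if "u z \<noteq> 0" for z
  proof -
    show z: "z \<in> int_lattice" "\<epsilon> *\<^sub>R z \<in> \<Omega>"
      using that by (auto simp: u_def split: if_splits)
    have "y (\<epsilon> *\<^sub>R z) \<noteq> 0"
      using that z by (simp add: u_def)
    then have "\<not> infdist (\<epsilon> *\<^sub>R z) (frontier \<Omega>) \<le> 2 * \<epsilon> * R0 R"
      using y(1) z scaled unfolding admissible_def by blast
    then show "infdist (\<epsilon> *\<^sub>R z) (frontier \<Omega>) > 2 * \<epsilon> * R0 R"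
      by simp
  qed
  show ?thesis
  proof (rule that [of T u])
    show "T \<subseteq> int_lattice"
      by (auto simp: T_def)
    have "T \<subseteq> (*\<^sub>R) (inverse \<epsilon>) ` \<Omega>"
    proof
      fix z assume "z \<in> T"
      then show "z \<in> (*\<^sub>R) (inverse \<epsilon>) ` \<Omega>"
        using \<open>\<epsilon> > 0\<close> by (intro image_eqI [where x = "\<epsilon> *\<^sub>R z"]) (auto simp: T_iff)
    qed
    then have "bounded T"
      using bounded_scaling [OF \<open>bounded \<Omega>\<close>] bounded_subset by blast
    with \<open>T \<subseteq> int_lattice\<close> show "finite T"
      by (rule finite_bounded_int_lattice)
    show "x \<in> T" if "u x \<noteq> 0" for x
      using supp [OF that] R0 by (simp add: T_iff)
    show "x \<in> T" if "\<rho> \<in> R" "u (x + \<rho>) \<noteq> 0" for x \<rho>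
    proof -
      have "(x + \<rho>) - \<rho> \<in> int_lattice"
        using supp(1) [OF that(2)] that(1) assms(2) by (intro int_lattice_diff) auto
      \<comment> \<open>Stepping back from the support uses up at most half of the margin
        \<open>2 * \<epsilon> * R0 R\<close>; what remains is the margin defining
        \<open>T\<close>.\<close>
      moreover have "infdist (\<epsilon> *\<^sub>R (x + \<rho>)) (frontier \<Omega>) > \<epsilon> * R0 R + norm (- (\<epsilon> *\<^sub>R \<rho>))"
        using supp(3) [OF that(2)] rho [OF that(1)] by simp
      then have "\<epsilon> *\<^sub>R (x + \<rho>) + - (\<epsilon> *\<^sub>R \<rho>) \<in> \<Omega>"
        "infdist (\<epsilon> *\<^sub>R (x + \<rho>) + - (\<epsilon> *\<^sub>R \<rho>)) (frontier \<Omega>) > \<epsilon> * R0 R"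
        using infdist_frontier_shift [OF supp(2) [OF that(2)] less_imp_le [OF R0]] by blast+
      ultimately show ?thesis
        by (simp add: T_iff scaleR_add_right)
    qed
    have "\<exists>x \<in> \<Omega> \<inter> scaled_lattice \<epsilon>. y x \<noteq> 0"
    proof (rule ccontr)
      assume "\<not> ?thesis"
      moreover have "y \<in> extensional (\<Omega> \<inter> scaled_lattice \<epsilon>)"
        using y(1) by (simp add: admissible_def PiE_def)
      ultimately have "y = (\<lambda>x\<in>\<Omega> \<inter> scaled_lattice \<epsilon>. 0)"
        by (intro extensionalityI [where A = "\<Omega> \<inter> scaled_lattice \<epsilon>"]) auto
      with y(2) show False ..
    qed
    then obtain z where "z \<in> int_lattice" "\<epsilon> *\<^sub>R z \<in> \<Omega>" "y (\<epsilon> *\<^sub>R z) \<noteq> 0"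
      by (auto simp: scaled_lattice_def)
    then have "u z \<noteq> 0"
      by (simp add: u_def)
    then show "u \<noteq> (\<lambda>_. 0)"
      by auto
    show "sint R \<epsilon> \<Omega> = (*\<^sub>R) \<epsilon> ` T"
      by (auto simp: T_def sint_def scaled_lattice_def)
    show "discrete_grad \<epsilon> y (\<epsilon> *\<^sub>R x) \<rho> = inverse \<epsilon> *\<^sub>R (u (x + \<rho>) - u x)"
      if "x \<in> T" "\<rho> \<in> R" for x \<rho>
    proof -
      \<comment> \<open>One step from \<open>T\<close> cannot leave \<open>\<Omega>\<close>, so
        \<open>u (x + \<rho>)\<close> is a genuine value of \<open>y\<close> and not the default
        0.\<close>
      have x: "x \<in> int_lattice" "\<epsilon> *\<^sub>R x \<in> \<Omega>" "infdist (\<epsilon> *\<^sub>R x) (frontier \<Omega>) > 0 + norm (\<epsilon> *\<^sub>R \<rho>)"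
        using that(1) rho [OF that(2)] by (simp_all add: T_iff)
      then have "\<epsilon> *\<^sub>R x + \<epsilon> *\<^sub>R \<rho> \<in> \<Omega>"
        by (intro infdist_frontier_shift(1) [where r = 0]) auto
      moreover have "x + \<rho> \<in> int_lattice"
        using x(1) that(2) assms(2) by (intro int_lattice_add) auto
      ultimately show ?thesis
        using x by (simp add: discrete_grad_def u_def scaleR_add_right)
    qed
  qed
qed

section \<open>Positivity of the atomistic constant\<close>

theorem corollary3p8:
  fixes R :: "(real ^ 'd) set"
    and K :: "'d \<Rightarrow> real ^ 'd \<Rightarrow> 'd \<Rightarrow> real ^ 'd \<Rightarrow> real"
    and \<Omega> :: "(real ^ 'd) set"
    and \<gamma> :: real
  assumes "finite R"
    and "R \<subseteq> int_lattice - {0}"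
    and "int_span R = int_lattice"
    and "R = uminus ` R"
    and "open \<Omega>" and "bounded \<Omega>" and "\<Omega> \<noteq> {}"
    and "\<forall>j l. \<forall>\<rho>\<in>R. \<forall>\<sigma>\<in>R. K j \<rho> l \<sigma> = K l \<sigma> j \<rho>"
    and "\<forall>j l. \<forall>\<rho>\<in>R. \<forall>\<sigma>\<in>R. K j \<rho> l \<sigma> = K j (- \<rho>) l (- \<sigma>)"
    and "lambda_LH R K > 0"
    and "\<forall>\<xi> k. tensor_form R K (outer_columns \<xi> (s_vec k)) (outer_columns \<xi> (s_vec k)) \<ge> 0"
    and "\<gamma> > 0"
    and "\<forall>\<xi> k. tensor_form R K (outer_columns \<xi> (c_vec k)) (outer_columns \<xi> (c_vec k))
                 \<ge> \<gamma> * (norm \<xi>)\<^sup>2 * (\<Sum>\<rho>\<in>R. (c_vec k \<rho>)\<^sup>2)"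
  shows "lambda_atom R \<Omega> K > 0"
proof -
  have R: "R \<subseteq> int_lattice"
    using assms(2) by blast
  have "R \<noteq> {}"
    using assms(3) int_span_empty_ne by metis
  obtain \<rho>0 where \<rho>0: "\<rho>0 \<in> R" "\<rho>0 \<noteq> 0"
    using assms(2) \<open>R \<noteq> {}\<close> by blast
  obtain t where t: "t > 0"
    and symbol: "\<And>\<xi> k. t * ((norm \<xi>)\<^sup>2 * ((\<Sum>\<rho>\<in>R. (c_vec k \<rho>)\<^sup>2) + (\<Sum>\<rho>\<in>R. (s_vec k \<rho>)\<^sup>2)))
       \<le> tensor_form R K (outer_columns \<xi> (c_vec k)) (outer_columns \<xi> (c_vec k))
       + tensor_form R K (outer_columns \<xi> (s_vec k)) (outer_columns \<xi> (s_vec k))"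
    by (rule symbol_coercive [OF assms(1) R assms(3,10) assms(11) [rule_format] assms(12)
          assms(13) [rule_format]], rule that)
  \<comment> \<open>The symbol constant \<open>t\<close> bounds every quotient at once; an empty
    inner infimum is infinite and causes no trouble.\<close>
  have "ereal t \<le> lambda_atom R \<Omega> K"
    unfolding lambda_atom_def
  proof (intro INF_greatest)
    fix \<epsilon> :: real and y
    assume "\<epsilon> \<in> {0<..}" and y: "y \<in> admissible R \<epsilon> \<Omega> - {\<lambda>x\<in>\<Omega> \<inter> scaled_lattice \<epsilon>. 0}"
    then have "\<epsilon> > 0" by simp
    have yA: "y \<in> admissible R \<epsilon> \<Omega>" and y0: "y \<noteq> (\<lambda>x\<in>\<Omega> \<inter> scaled_lattice \<epsilon>. 0)"
      using y by blast+
    obtain T u where T: "finite T" "T \<subseteq> int_lattice"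
      and u: "\<And>x. u x \<noteq> 0 \<Longrightarrow> x \<in> T" "\<And>x \<rho>. \<rho> \<in> R \<Longrightarrow> u (x + \<rho>) \<noteq> 0 \<Longrightarrow> x \<in> T"
      and "u \<noteq> (\<lambda>_. 0)"
      and sint: "sint R \<epsilon> \<Omega> = (*\<^sub>R) \<epsilon> ` T"
      and grad: "\<And>x \<rho>. x \<in> T \<Longrightarrow> \<rho> \<in> R \<Longrightarrow>
        discrete_grad \<epsilon> y (\<epsilon> *\<^sub>R x) \<rho> = inverse \<epsilon> *\<^sub>R (u (x + \<rho>) - u x)"
      by (rule admissible_rescale [OF assms(1) R assms(6) \<open>\<epsilon> > 0\<close> yA y0], rule that)
    from \<open>u \<noteq> (\<lambda>_. 0)\<close> obtain z where "u z \<noteq> 0"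
      by blast
    define N where "N = (\<Sum>x\<in>T. tensor_form R K (\<lambda>\<rho>. u (x + \<rho>) - u x) (\<lambda>\<rho>. u (x + \<rho>) - u x))"
    define D where "D = (\<Sum>x\<in>T. columns_norm_sq R (\<lambda>\<rho>. u (x + \<rho>) - u x))"
    \<comment> \<open>Positivity is essential here: division by zero yields 0, which would violate
      the bound by \<open>t\<close>.\<close>
    have "D > 0"
      unfolding D_def
      by (rule sum_columns_norm_sq_pos [where u = u, OF assms(1) \<rho>0 T(1) u(1) \<open>u z \<noteq> 0\<close>])
    have "t * D \<le> N"
      unfolding D_def N_def by (rule sum_tensor_form_coercive [where u = u, OF assms(1,4,9) symbol T u])
    have inj: "inj_on ((*\<^sub>R) \<epsilon>) T"
      using \<open>\<epsilon> > 0\<close> by (simp add: inj_on_def)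
    \<comment> \<open>Numerator and denominator both acquire the factor
      \<open>(inverse \<epsilon>)\<^sup>2\<close>, which cancels, making the bound independent of
      \<open>\<epsilon>\<close>.\<close>
    have "(\<Sum>x\<in>sint R \<epsilon> \<Omega>. tensor_form R K (discrete_grad \<epsilon> y x) (discrete_grad \<epsilon> y x))
        = (\<Sum>x\<in>T. (inverse \<epsilon>)\<^sup>2 * tensor_form R K (\<lambda>\<rho>. u (x + \<rho>) - u x) (\<lambda>\<rho>. u (x + \<rho>) - u x))"
      unfolding sint sum.reindex [OF inj] o_def
    proof (rule sum.cong [OF refl])
      fix x assume "x \<in> T"
      then have "tensor_form R K (discrete_grad \<epsilon> y (\<epsilon> *\<^sub>R x)) (discrete_grad \<epsilon> y (\<epsilon> *\<^sub>R x))
          = tensor_form R K (\<lambda>\<rho>. inverse \<epsilon> *\<^sub>R (u (x + \<rho>) - u x)) (\<lambda>\<rho>. inverse \<epsilon> *\<^sub>R (u (x + \<rho>) - u x))"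
        by (intro tensor_form_cong grad)
      then show "tensor_form R K (discrete_grad \<epsilon> y (\<epsilon> *\<^sub>R x)) (discrete_grad \<epsilon> y (\<epsilon> *\<^sub>R x))
          = (inverse \<epsilon>)\<^sup>2 * tensor_form R K (\<lambda>\<rho>. u (x + \<rho>) - u x) (\<lambda>\<rho>. u (x + \<rho>) - u x)"
        by (simp only: tensor_form_scale_left tensor_form_scale_right power2_eq_square mult.assoc)
    qed
    then have num: "(\<Sum>x\<in>sint R \<epsilon> \<Omega>. tensor_form R K (discrete_grad \<epsilon> y x) (discrete_grad \<epsilon> y x))
        = (inverse \<epsilon>)\<^sup>2 * N"
      by (simp add: N_def sum_distrib_left)
    have "(\<Sum>x\<in>sint R \<epsilon> \<Omega>. columns_norm_sq R (discrete_grad \<epsilon> y x))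
        = (\<Sum>x\<in>T. (inverse \<epsilon>)\<^sup>2 * columns_norm_sq R (\<lambda>\<rho>. u (x + \<rho>) - u x))"
      unfolding sint sum.reindex [OF inj] o_def columns_norm_sq_scale [symmetric]
      by (intro sum.cong refl) (simp add: columns_norm_sq_def grad)
    then have den: "(\<Sum>x\<in>sint R \<epsilon> \<Omega>. columns_norm_sq R (discrete_grad \<epsilon> y x)) = (inverse \<epsilon>)\<^sup>2 * D"
      by (simp add: D_def sum_distrib_left)
    have "t \<le> N / D"
      using \<open>t * D \<le> N\<close> \<open>D > 0\<close> by (simp add: field_simps)
    also have "\<dots> = ((inverse \<epsilon>)\<^sup>2 * N) / ((inverse \<epsilon>)\<^sup>2 * D)"
      using \<open>\<epsilon> > 0\<close> by simp
    finally show "ereal t \<le> ereal ((\<Sum>x\<in>sint R \<epsilon> \<Omega>. tensor_form R K (discrete_grad \<epsilon> y x) (discrete_grad \<epsilon> y x))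
        / (\<Sum>x\<in>sint R \<epsilon> \<Omega>. columns_norm_sq R (discrete_grad \<epsilon> y x)))"
      unfolding num den by simp
  qed
  moreover have "0 < ereal t"
    using t by simp
  ultimately show ?thesis
    by (rule less_le_trans [rotated])
qed

end
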